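(* Let $\mathcal M$ be a reflexible map of Class III, with automorphism group $G=\langle\rho_0,\rho_1,\rho_2\rangle$, where $\rho_0,\rho_1,\rho_2$ are the distinguished generators with respect to a chosen flag. Let $\Gamma(\mathcal M)=\Gamma(G;\{G_0,G_1,G_2,G_3\})$ be the rank four coset pregeometry with $G_0=\langle\rho_0,\rho_1\rangle$, $G_1=\langle\rho_0,\rho_2\rangle$, $G_2=\langle\rho_1,\rho_2\rangle$, $G_3=\langle\rho_1,\rho_0\rho_2\rangle$. Then $\Gamma(\mathcal M)$ has trialities but no dualities.
   Context: Maps. A map is a 2-cell embedding of a graph into a closed surface without boundary. Its flags are the triples (vertex, edge, face) of pairwise incident elements. It is reflexible if its automorphism group $G$ has a unique orbit on flags. For a chosen flag $\{v,e,f\}$ of a reflexible map, $G$ is generated by three involutions (the distinguished generators) $\rho_0,\rho_1,\rho_2$, where $\rho_0$ and $\rho_2$ commute and $\rho_0\rho_2$ has order 2: $\rho_0$ fixes $e,f$ and moves $v$ to the other end of $e$; $\rho_1$ fixes $v,f$ and moves $e$; $\rho_2$ fixes $v,e$ and moves $f$. Two reflexible maps given by triples $(\rho_0,\rho_1,\rho_2)$ and $(\rho_0',\rho_1',\rho_2')$ generating $G$ and $G'$ are isomorphic if and only if there is a group isomorphism $G\to G'$ with $\rho_i\mapsto\rho_i'$ for $i=0,1,2$. Wilson's operations on reflexible maps are generated by the duality $D$, sending $(\rho_0,\rho_1,\rho_2)$ to $(\rho_2,\rho_1,\rho_0)$, and the Petrie duality $P$, sending $(\rho_0,\rho_1,\rho_2)$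 to $(\rho_0\rho_2,\rho_1,\rho_2)$; they generate a group isomorphic to $S_3$. A reflexible map is of Class III if its six images under this group split into exactly two isomorphism classes, each containing three of them; equivalently, the map is isomorphic to its images under the order-3 operations $DP$ and $PD$, but not to its images under $D$, $P$ or $DPD=PDP$. Geometries. A pregeometry is a quadruple $(X,*,t,I)$ with $X$ a set of elements, $I$ a finite set of types, $t:X\to I$ a surjective type function, and $*$ a symmetric incidence relation on $X$ such that elements of the same type are not incident; its rank is $|I|$. The coset pregeometry $\Gamma(G;\{H_i\}_{i\in I})$ has as elements of type $i$ the left cosets $gH_i$, $g\in G$ (cosets of subgroups with different indices are regarded as different elements), and two elements of distinct types are incident if and only if their intersection is non-empty. A correlation is a permutation $\alpha$ of $X$ such that for all $x,y\in X$, $t(x)=t(y)\iff t(\alpha(x))=t(\alpha(y))$ and $x*y\iff\alpha(x)*\alpha(y)$. A triality is a correlation of order $3$ permuting three types cyclically. A duality is a correlation of order $2$ interchanging two types.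
   Formalization: The distinguished generators are required to be the only automorphisms with their stated fixing and moving properties (so only two edges are incident with both v and f); without this, for graphs with multiple edges, the claim can fail. *)

theory Defs
  imports
    "HOL-Analysis.Analysis"
    "HOL-Combinatorics.Permutations"
    "HOL-Algebra.Bij"
    "HOL-Algebra.Multiplicative_Group"
    "HOL-Algebra.Generated_Groups"
    "HOL-Algebra.Group_Action"
begin

section \<open>Maps on closed surfaces\<close>

definition homeomorphic_to_disc :: "'a topology \<Rightarrow> 'a set \<Rightarrow> bool" where
  "homeomorphic_to_disc S U \<longleftrightarrow>
     subtopology S U homeomorphic_space top_of_set (ball (0 :: real^2) 1)"

definition closed_surface :: "'a topology \<Rightarrow> bool" where
  "closed_surface S \<longleftrightarrow>
     compact_space S \<and> connected_space S \<and> Hausdorff_space S \<and>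
     (\<forall>x \<in> topspace S. \<exists>U. openin S U \<and> x \<in> U \<and> homeomorphic_to_disc S U)"

text \<open>
  An embedded graph is given by its set of vertices (points of the surface) and its set of edges,
  where an edge is the open arc without its end points. Loops and multiple edges are allowed.
\<close>

record 'a surface_map =
  surface :: "'a topology"
  vertices :: "'a set"
  edges :: "'a set set"

definition open_edge :: "'a topology \<Rightarrow> 'a set \<Rightarrow> 'a set \<Rightarrow> bool" where
  "open_edge S V e \<longleftrightarrow>
     (\<exists>p. pathin S p \<and> inj_on p {0<..<1} \<and> p 0 \<in> V \<and> p 1 \<in> V \<and>
          e = p ` {0<..<1} \<and> e \<inter> V = {})"

definition faces :: "'a surface_map \<Rightarrow> 'a set set" where
  "faces M = connected_components_of
     (subtopology (surface M) (topspace (surface M) - (vertices M \<union> \<Union>(edges M))))"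

definition is_map :: "'a surface_map \<Rightarrow> bool" where
  "is_map M \<longleftrightarrow>
     closed_surface (surface M) \<and>
     finite (vertices M) \<and> vertices M \<noteq> {} \<and> vertices M \<subseteq> topspace (surface M) \<and>
     finite (edges M) \<and> (\<forall>e \<in> edges M. open_edge (surface M) (vertices M) e) \<and>
     disjoint (edges M) \<and>
     (\<forall>f \<in> faces M. homeomorphic_to_disc (surface M) f)"

text \<open>
  All elements of a map (vertices, edges, faces) are represented as subsets of the surface, a vertex
  \<open>v\<close> being represented by \<open>{v}\<close>. Two elements of different kinds are incident when the one of
  smaller dimension lies in the closure of the other.
\<close>

definition vertex_cells :: "'a surface_map \<Rightarrow> 'a set set" where
  "vertex_cells M = (\<lambda>v. {v}) ` vertices M"

definition cells :: "'a surface_map \<Rightarrow> 'a set set" where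
  "cells M = vertex_cells M \<union> edges M \<union> faces M"

definition in_closure :: "'a surface_map \<Rightarrow> 'a set \<Rightarrow> 'a set \<Rightarrow> bool" where
  "in_closure M c d \<longleftrightarrow> c \<subseteq> surface M closure_of d"

definition flags :: "'a surface_map \<Rightarrow> ('a set \<times> 'a set \<times> 'a set) set" where
  "flags M = {(v, e, f). v \<in> vertex_cells M \<and> e \<in> edges M \<and> f \<in> faces M \<and>
     in_closure M v e \<and> in_closure M e f \<and> in_closure M v f}"

text \<open>
  An automorphism of a map is a permutation of its elements induced by a self-homeomorphism of the
  surface that preserves the embedded graph.
\<close>

definition map_homeomorphism :: "'a surface_map \<Rightarrow> ('a \<Rightarrow> 'a) \<Rightarrow> bool" where
  "map_homeomorphism M h \<longleftrightarrow>
     homeomorphic_map (surface M) (surface M) h \<and>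
     h ` vertices M = vertices M \<and> (`) h ` edges M = edges M"

definition aut_group :: "'a surface_map \<Rightarrow> ('a set \<Rightarrow> 'a set) monoid" where
  "aut_group M = (BijGroup (cells M))
     \<lparr>carrier := {restrict ((`) h) (cells M) | h. map_homeomorphism M h}\<rparr>"

lemma cells_subset_topspace:
  assumes "is_map M" and "c \<in> cells M"
  shows "c \<subseteq> topspace (surface M)"
proof -
  have "e \<subseteq> topspace (surface M)" if "e \<in> edges M" for e
  proof -
    have "open_edge (surface M) (vertices M) e"
      using assms(1) that by (simp add: is_map_def)
    then show ?thesis
      unfolding open_edge_def pathin_def continuous_map_def by force
  qed
  moreover have "f \<subseteq> topspace (surface M)" if "f \<in> faces M" for f
    using connected_components_of_subset[of f] that by (fastforce simp: faces_def)
  moreover have "vertices M \<subseteq> topspace (surface M)"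
    using assms(1) by (simp add: is_map_def)
  ultimately show ?thesis
    using assms(2) by (auto simp: cells_def vertex_cells_def)
qed

lemma map_homeomorphism_cells:
  assumes M: "is_map M" and h: "map_homeomorphism M h"
  shows "restrict ((`) h) (cells M) \<in> Bij (cells M)"
    and "\<exists>k. map_homeomorphism M k \<and> (\<forall>x \<in> topspace (surface M). k (h x) = x)"
proof -
  let ?S = "surface M" and ?V = "vertices M" and ?E = "edges M"
  let ?C = "topspace ?S - (?V \<union> \<Union>?E)"
  have hom: "homeomorphic_map ?S ?S h" and hV: "h ` ?V = ?V" and hE: "(`) h ` ?E = ?E"
    using h by (auto simp: map_homeomorphism_def)
  have sub: "cells M \<subseteq> Pow (topspace ?S)"
    using cells_subset_topspace[OF M] by blast
  then have V: "?V \<subseteq> topspace ?S" and E: "\<Union>?E \<subseteq> topspace ?S"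
    by (auto simp: cells_def vertex_cells_def)
  have inj: "inj_on h (topspace ?S)"
    using hom by (simp add: homeomorphic_map_def)
  have surj: "h ` topspace ?S = topspace ?S"
    using hom by (simp add: homeomorphic_imp_surjective_map)
  have hUE: "h ` \<Union>?E = \<Union>?E"
    using hE by (metis image_Union)
  have hC: "h ` ?C = ?C"
  proof -
    have "h ` ?C = h ` topspace ?S - h ` (?V \<union> \<Union>?E)"
      using V E by (intro inj_on_image_set_diff[OF inj]) auto
    then show ?thesis
      by (simp only: surj image_Un hV hUE)
  qed
  have homC: "homeomorphic_map (subtopology ?S ?C) (subtopology ?S ?C) h"
    by (rule homeomorphic_map_subtopologies[OF hom])
      (metis hC Diff_subset inf.absorb2)
  have hF: "(`) h ` faces M = faces M"
    using homeomorphic_map_connected_components_of[OF homC] by (simp add: faces_def)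
  have hvc: "(`) h ` vertex_cells M = vertex_cells M"
    unfolding vertex_cells_def image_image using hV by (metis (no_types, lifting) image_cong image_empty image_image image_insert)
  have "inj_on ((`) h) (cells M)"
    using inj_on_image_Pow[OF inj] sub by (rule inj_on_subset)
  moreover have "(`) h ` cells M = cells M"
    by (simp add: cells_def image_Un hvc hE hF)
  ultimately show "restrict ((`) h) (cells M) \<in> Bij (cells M)"
    by (simp add: Bij_def bij_betw_def inj_on_restrict_eq)
  obtain k where k: "homeomorphic_maps ?S ?S h k"
    using hom by (auto simp: homeomorphic_map_maps)
  then have kh: "k (h x) = x" if "x \<in> topspace ?S" for x
    using that by (simp add: homeomorphic_maps_def)
  have khA: "k ` h ` A = A" if "A \<subseteq> topspace ?S" for A
    using kh that by (force simp: image_image)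
  have "k ` ?V = ?V"
    using khA[OF V] hV by simp
  moreover have "(`) k ` ?E = ?E"
  proof -
    have "(`) k ` (`) h ` ?E = ?E"
      using khA E by (simp add: image_image[of "(`) k"] Sup_le_iff cong: image_cong_simp)
    then show ?thesis
      by (simp only: hE)
  qed
  moreover have "homeomorphic_map ?S ?S k"
    using k homeomorphic_map_maps homeomorphic_maps_sym by blast
  ultimately show "\<exists>k. map_homeomorphism M k \<and> (\<forall>x \<in> topspace ?S. k (h x) = x)"
    using kh by (auto simp: map_homeomorphism_def)
qed

lemma group_aut_group:
  assumes M: "is_map M"
  shows "group (aut_group M)"
proof -
  let ?X = "cells M" and ?B = "BijGroup (cells M)"
  let ?A = "{restrict ((`) h) ?X | h. map_homeomorphism M h}"
  interpret B: group ?B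
    by (rule group_BijGroup)
  have comp: "restrict ((`) h) ?X \<otimes>\<^bsub>?B\<^esub> restrict ((`) k) ?X = restrict ((`) (h \<circ> k)) ?X"
    if "map_homeomorphism M h" "map_homeomorphism M k" for h k
  proof -
    have "restrict ((`) k) ?X \<in> Bij ?X" "restrict ((`) h) ?X \<in> Bij ?X"
      using map_homeomorphism_cells(1)[OF M] that by auto
    moreover from this(1) have "k ` c \<in> ?X" if "c \<in> ?X" for c
      using Bij_imp_funcset[THEN funcset_mem, of _ ?X c] that by fastforce
    ultimately show ?thesis
      by (simp add: BijGroup_def compose_def image_comp cong: restrict_cong)
  qed
  have closed: "map_homeomorphism M (h \<circ> k)"
    if "map_homeomorphism M h" "map_homeomorphism M k" for h k
  proof -
    have "(`) (h \<circ> k) ` edges M = (`) h ` (`) k ` edges M"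
      by (simp add: image_comp comp_def)
    then show ?thesis
      using that unfolding map_homeomorphism_def
      by (metis homeomorphic_map_compose image_comp)
  qed
  have one: "map_homeomorphism M id" "restrict ((`) id) ?X = \<one>\<^bsub>?B\<^esub>"
    by (auto simp: map_homeomorphism_def homeomorphic_map_id BijGroup_def fun_eq_iff restrict_def)
  have "subgroup ?A ?B"
  proof (rule B.subgroupI)
    show "?A \<subseteq> carrier ?B"
      using map_homeomorphism_cells(1)[OF M] by (auto simp: BijGroup_def)
    show "?A \<noteq> {}"
      using one by blast
    show "a \<otimes>\<^bsub>?B\<^esub> b \<in> ?A" if "a \<in> ?A" "b \<in> ?A" for a b
      using that comp closed by blast
    show "inv\<^bsub>?B\<^esub> a \<in> ?A" if "a \<in> ?A" for a
    proof -
      obtain h where h: "map_homeomorphism M h" "a = restrict ((`) h) ?X"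
        using \<open>a \<in> ?A\<close> by blast
      obtain k where k: "map_homeomorphism M k" "\<And>x. x \<in> topspace (surface M) \<Longrightarrow> k (h x) = x"
        using map_homeomorphism_cells(2)[OF M h(1)] by blast
      have "(k \<circ> h) ` c = c" if "c \<in> ?X" for c
        using cells_subset_topspace[OF M that] k(2) by force
      then have "restrict ((`) (k \<circ> h)) ?X = \<one>\<^bsub>?B\<^esub>"
        by (simp add: BijGroup_def cong: restrict_cong)
      then have "restrict ((`) k) ?X \<otimes>\<^bsub>?B\<^esub> a = \<one>\<^bsub>?B\<^esub>"
        using comp[OF k(1) h(1)] h(2) by simp
      moreover have "restrict ((`) k) ?X \<in> carrier ?B" "a \<in> carrier ?B"
        using map_homeomorphism_cells(1)[OF M] k(1) h by (auto simp: BijGroup_def)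
      ultimately have "inv\<^bsub>?B\<^esub> a = restrict ((`) k) ?X"
        by (simp add: B.inv_equality)
      then show ?thesis
        using k(1) by blast
    qed
  qed
  then show ?thesis
    unfolding aut_group_def by (rule B.subgroup_imp_group)
qed

definition reflexible :: "'a surface_map \<Rightarrow> bool" where
  "reflexible M \<longleftrightarrow> is_map M \<and>
     (\<exists>A. orbits (aut_group M) (flags M) (\<lambda>g (v, e, f). (g v, g e, g f)) = {A})"

text \<open>
  The conditions determining \<open>\<rho>\<^sub>0, \<rho>\<^sub>1, \<rho>\<^sub>2\<close> from the chosen flag are read as unique descriptions:
  \<open>\<rho>\<^sub>0\<close> is the automorphism fixing \<open>e\<close> and \<open>f\<close> but not \<open>v\<close> (it then maps \<open>v\<close> to the other end of \<open>e\<close>),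
  and similarly for \<open>\<rho>\<^sub>1\<close> and \<open>\<rho>\<^sub>2\<close>. This is a non-degeneracy condition. For \<open>\<rho>\<^sub>1\<close> it says that only
  two edges are incident with both \<open>v\<close> and \<open>f\<close>. Otherwise distinct edges may have the same
  incidences, and the incidence structure no longer determines the map.
\<close>

definition distinguished_generators ::
    "'a surface_map \<Rightarrow> 'a set \<times> 'a set \<times> 'a set \<Rightarrow>
     ('a set \<Rightarrow> 'a set) \<times> ('a set \<Rightarrow> 'a set) \<times> ('a set \<Rightarrow> 'a set) \<Rightarrow> bool" where
  "distinguished_generators M = (\<lambda>(v, e, f) (\<rho>0, \<rho>1, \<rho>2).
     let G = aut_group M in
       {g \<in> carrier G. g e = e \<and> g f = f \<and> g v \<noteq> v} = {\<rho>0} \<and>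
       {g \<in> carrier G. g v = v \<and> g f = f \<and> g e \<noteq> e} = {\<rho>1} \<and>
       {g \<in> carrier G. g v = v \<and> g e = e \<and> g f \<noteq> f} = {\<rho>2} \<and>
       group.ord G \<rho>0 = 2 \<and> group.ord G \<rho>1 = 2 \<and> group.ord G \<rho>2 = 2 \<and>
       \<rho>0 \<otimes>\<^bsub>G\<^esub> \<rho>2 = \<rho>2 \<otimes>\<^bsub>G\<^esub> \<rho>0 \<and> group.ord G (\<rho>0 \<otimes>\<^bsub>G\<^esub> \<rho>2) = 2 \<and>
       generate G {\<rho>0, \<rho>1, \<rho>2} = carrier G)"


section \<open>Wilson's operations\<close>

definition triple_iso ::
    "('g, 'm) monoid_scheme \<Rightarrow> 'g \<times> 'g \<times> 'g \<Rightarrow> ('h, 'n) monoid_scheme \<Rightarrow> 'h \<times> 'h \<times> 'h \<Rightarrow> bool" where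
  "triple_iso G = (\<lambda>(a, b, c) H (a', b', c').
     \<exists>h \<in> iso G H. h a = a' \<and> h b = b' \<and> h c = c')"

definition dual_op :: "'g \<times> 'g \<times> 'g \<Rightarrow> 'g \<times> 'g \<times> 'g" where
  "dual_op = (\<lambda>(a, b, c). (c, b, a))"

definition petrie_op :: "('g, 'm) monoid_scheme \<Rightarrow> 'g \<times> 'g \<times> 'g \<Rightarrow> 'g \<times> 'g \<times> 'g" where
  "petrie_op G = (\<lambda>(a, b, c). (a \<otimes>\<^bsub>G\<^esub> c, b, c))"

inductive_set wilson_images :: "('g, 'm) monoid_scheme \<Rightarrow> 'g \<times> 'g \<times> 'g \<Rightarrow> ('g \<times> 'g \<times> 'g) set"
  for G and \<rho> where
  self: "\<rho> \<in> wilson_images G \<rho>"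
| dual: "x \<in> wilson_images G \<rho> \<Longrightarrow> dual_op x \<in> wilson_images G \<rho>"
| petrie: "x \<in> wilson_images G \<rho> \<Longrightarrow> petrie_op G x \<in> wilson_images G \<rho>"

definition class_III :: "('g, 'm) monoid_scheme \<Rightarrow> 'g \<times> 'g \<times> 'g \<Rightarrow> bool" where
  "class_III G \<rho> \<longleftrightarrow>
     (let W = wilson_images G \<rho>;
          isomorphism_classes = W // {(x, y). x \<in> W \<and> y \<in> W \<and> triple_iso G x G y}
      in card isomorphism_classes = 2 \<and> (\<forall>C \<in> isomorphism_classes. card C = 3))"


section \<open>Pregeometries and their correlations\<close>

record ('x, 'i) pregeom =
  elements :: "'x set"
  types :: "'i set"
  type_of :: "'x \<Rightarrow> 'i"
  incident :: "'x \<Rightarrow> 'x \<Rightarrow> bool"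

definition pregeometry :: "('x, 'i) pregeom \<Rightarrow> bool" where
  "pregeometry \<Gamma> \<longleftrightarrow>
     finite (types \<Gamma>) \<and> type_of \<Gamma> ` elements \<Gamma> = types \<Gamma> \<and>
     (\<forall>x \<in> elements \<Gamma>. \<forall>y \<in> elements \<Gamma>. incident \<Gamma> x y \<longrightarrow> incident \<Gamma> y x) \<and>
     (\<forall>x \<in> elements \<Gamma>. \<forall>y \<in> elements \<Gamma>. type_of \<Gamma> x = type_of \<Gamma> y \<longrightarrow> \<not> incident \<Gamma> x y)"

definition coset_pregeometry ::
    "('g, 'm) monoid_scheme \<Rightarrow> 'i set \<Rightarrow> ('i \<Rightarrow> 'g set) \<Rightarrow> ('i \<times> 'g set, 'i) pregeom" where
  "coset_pregeometry G I H =
     \<lparr>elements = {(i, g <#\<^bsub>G\<^esub> H i) | i g. i \<in> I \<and> g \<in> carrier G},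
      types = I,
      type_of = fst,
      incident = (\<lambda>(i, A) (j, B). i \<noteq> j \<and> A \<inter> B \<noteq> {})\<rparr>"

lemma pregeometry_coset_pregeometry:
  assumes "group G" and "finite I"
  shows "pregeometry (coset_pregeometry G I H)"
proof -
  have "\<one>\<^bsub>G\<^esub> \<in> carrier G"
    using assms(1) by (simp add: group.is_monoid monoid.one_closed)
  then have "fst ` {(i, g <#\<^bsub>G\<^esub> H i) | i g. i \<in> I \<and> g \<in> carrier G} = I"
    by force
  then show ?thesis
    using assms(2) by (auto simp: pregeometry_def coset_pregeometry_def)
qed

definition correlation :: "('x, 'i) pregeom \<Rightarrow> ('x \<Rightarrow> 'x) \<Rightarrow> bool" where
  "correlation \<Gamma> \<alpha> \<longleftrightarrow> \<alpha> permutes elements \<Gamma> \<and>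
     (\<forall>x \<in> elements \<Gamma>. \<forall>y \<in> elements \<Gamma>.
        (type_of \<Gamma> x = type_of \<Gamma> y \<longleftrightarrow> type_of \<Gamma> (\<alpha> x) = type_of \<Gamma> (\<alpha> y)) \<and>
        (incident \<Gamma> x y \<longleftrightarrow> incident \<Gamma> (\<alpha> x) (\<alpha> y)))"

definition has_order :: "('x \<Rightarrow> 'x) \<Rightarrow> nat \<Rightarrow> bool" where
  "has_order \<alpha> n \<longleftrightarrow> 0 < n \<and> \<alpha> ^^ n = id \<and> (\<forall>m. 0 < m \<and> m < n \<longrightarrow> \<alpha> ^^ m \<noteq> id)"

definition maps_type :: "('x, 'i) pregeom \<Rightarrow> ('x \<Rightarrow> 'x) \<Rightarrow> 'i \<Rightarrow> 'i \<Rightarrow> bool" where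
  "maps_type \<Gamma> \<alpha> i j \<longleftrightarrow> (\<forall>x \<in> elements \<Gamma>. type_of \<Gamma> x = i \<longrightarrow> type_of \<Gamma> (\<alpha> x) = j)"

definition triality :: "('x, 'i) pregeom \<Rightarrow> ('x \<Rightarrow> 'x) \<Rightarrow> bool" where
  "triality \<Gamma> \<alpha> \<longleftrightarrow> correlation \<Gamma> \<alpha> \<and> has_order \<alpha> 3 \<and>
     (\<exists>i \<in> types \<Gamma>. \<exists>j \<in> types \<Gamma>. \<exists>k \<in> types \<Gamma>. i \<noteq> j \<and> j \<noteq> k \<and> i \<noteq> k \<and>
        maps_type \<Gamma> \<alpha> i j \<and> maps_type \<Gamma> \<alpha> j k \<and> maps_type \<Gamma> \<alpha> k i)"

definition duality :: "('x, 'i) pregeom \<Rightarrow> ('x \<Rightarrow> 'x) \<Rightarrow> bool" where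
  "duality \<Gamma> \<alpha> \<longleftrightarrow> correlation \<Gamma> \<alpha> \<and> has_order \<alpha> 2 \<and>
     (\<exists>i \<in> types \<Gamma>. \<exists>j \<in> types \<Gamma>. i \<noteq> j \<and> maps_type \<Gamma> \<alpha> i j \<and> maps_type \<Gamma> \<alpha> j i)"

definition wilson_pregeometry ::
    "('g, 'm) monoid_scheme \<Rightarrow> 'g \<times> 'g \<times> 'g \<Rightarrow> (nat \<times> 'g set, nat) pregeom" where
  "wilson_pregeometry G = (\<lambda>(\<rho>0, \<rho>1, \<rho>2).
     coset_pregeometry G {0, 1, 2, 3}
       ((!) [generate G {\<rho>0, \<rho>1}, generate G {\<rho>0, \<rho>2},
             generate G {\<rho>1, \<rho>2}, generate G {\<rho>1, \<rho>0 \<otimes>\<^bsub>G\<^esub> \<rho>2}]))"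

end

theory Submission
  imports Defs
begin

text \<open>
  Write \<open>G\<^sub>0, G\<^sub>1, G\<^sub>2, G\<^sub>3\<close> for the four subgroups that define the geometry. The conjugates of \<open>G\<^sub>1\<close>
  stabilise edges, and each of the other three is generated by \<open>\<rho>\<^sub>1\<close> and one of the three
  involutions \<open>\<rho>\<^sub>0\<close>, \<open>\<rho>\<^sub>2\<close>, \<open>\<rho>\<^sub>0\<rho>\<^sub>2\<close> of the Klein four group \<open>G\<^sub>1\<close>. Class III means that the automorphisms of
  \<open>G\<close> that fix \<open>\<rho>\<^sub>1\<close> and permute these three involutions induce exactly the cyclic permutations
  (\<open>class_III_automorphisms\<close>).

  An automorphism of order three permutes \<open>G\<^sub>0, G\<^sub>2, G\<^sub>3\<close> cyclically and preserves \<open>G\<^sub>1\<close>; acting on cosets,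
  it is a triality (\<open>automorphism_induces_correlation\<close>).

  Conversely, a duality would produce a forbidden transposition. The geometry need not be flag
  transitive under \<open>G\<close>, nor need its correlations come from automorphisms of \<open>G\<close>. However, by the
  choice of the generators two of the subgroups meet only in the expected subgroup of order two,
  and this suffices to identify \<open>G\<close> with the set of flags that consist of an edge and elements of two
  further types. A correlation that preserves edges and exchanges the two further types
  thus acts on \<open>G\<close>, and adjacency of flags shows that the action is, up to a translation, an
  automorphism transposing two involutions (\<open>correlation_swap_imp_automorphism\<close>).

  It remains to see that a correlation preserves edges. An edge has at most two neighbours of any
  other type. If a coset of \<open>G\<^sub>0\<close>, \<open>G\<^sub>2\<close> or \<open>G\<^sub>3\<close> could be sent to an edge, then it would have at most two edges, and one
  of the involutions would commute with \<open>\<rho>\<^sub>1\<close> (\<open>commute_if_mapped_to_edge\<close>). By the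
  automorphism of order three all of them would, and in the resulting elementary abelian group the
  involutions can be transposed (\<open>abelian_imp_swap\<close>).
\<close>

section \<open>Left cosets\<close>

lemma (in group) l_coset_eq_iff:
  assumes "subgroup H G" "x \<in> carrier G" "y \<in> carrier G"
  shows "x <# H = y <# H \<longleftrightarrow> inv x \<otimes> y \<in> H"
proof
  assume "x <# H = y <# H"
  then have "y \<in> x <# H"
    using assms subgroup.one_closed[OF assms(1)] by (force simp: l_coset_def)
  then obtain h where "h \<in> H" "y = x \<otimes> h"
    by (auto simp: l_coset_def)
  then show "inv x \<otimes> y \<in> H"
    using assms subgroup.mem_carrier[OF assms(1)] by (simp add: m_assoc[symmetric])
next
  assume "inv x \<otimes> y \<in> H"
  moreover have "y = x \<otimes> (inv x \<otimes> y)"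
    using assms by (simp add: m_assoc[symmetric])
  ultimately have "y \<in> x <# H"
    by (auto simp: l_coset_def)
  then show "x <# H = y <# H"
    using assms by (intro l_repr_independence)
qed

lemma (in group) l_coset_mult_right:
  assumes "subgroup H G" "x \<in> carrier G" "h \<in> H"
  shows "(x \<otimes> h) <# H = x <# H"
  using assms subgroup.mem_carrier[OF assms(1)]
  by (subst eq_commute, subst l_coset_eq_iff) (auto simp: m_assoc[symmetric])

lemma (in group) l_cosets_meet_obtain:
  assumes "subgroup H G" "subgroup K G" "x \<in> carrier G" "y \<in> carrier G"
    and "(x <# K) \<inter> (y <# H) \<noteq> {}"
  obtains p where "p \<in> K" "y <# H = (x \<otimes> p) <# H"
proof -
  obtain p h where ph: "p \<in> K" "h \<in> H" "x \<otimes> p = y \<otimes> h"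
    using assms(5) by (auto simp: l_coset_def)
  then have "(x \<otimes> p) <# H = y <# H"
    using l_coset_mult_right[OF assms(1,4)] by simp
  then show thesis
    using that ph(1) by simp
qed

lemma (in group) l_cosets_meet:
  assumes "subgroup H G" "subgroup K G" "x \<in> carrier G" "h \<in> H"
  shows "((x \<otimes> h) <# K) \<inter> (x <# H) \<noteq> {}"
proof -
  have "x \<otimes> h \<in> (x \<otimes> h) <# K"
    using assms subgroup.one_closed[OF assms(2)] subgroup.mem_carrier[OF assms(1)]
    by (force simp: l_coset_def)
  then show ?thesis
    using assms(4) by (auto simp: l_coset_def)
qed

section \<open>Three involutions with independent parabolic subgroups\<close>

text \<open>
  The involutions \<open>s\<close> and \<open>t\<close> play the part of two of the three involutions of the stabiliser of an edge,
  and \<open>b\<close> that of \<open>\<rho>\<^sub>1\<close>. All six ordered pairs \<open>(s, t)\<close> from \<open>\<rho>\<^sub>0, \<rho>\<^sub>2, \<rho>\<^sub>0\<rho>\<^sub>2\<close> generate the same Klein four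
  group, so an argument carried out for one pair applies to any two of the three types other than
  the edges. The hypotheses \<open>meets\<close> say that the base flag can be changed in only one way
  while two of its elements are kept.
\<close>

locale edge_involutions = group G for G (structure) +
  fixes s b t
  assumes closed [simp]: "s \<in> carrier G" "b \<in> carrier G" "t \<in> carrier G"
    and involutions [simp]: "s \<otimes> s = \<one>" "b \<otimes> b = \<one>" "t \<otimes> t = \<one>"
    and commute: "t \<otimes> s = s \<otimes> t"
    and distinct: "s \<noteq> \<one>" "t \<noteq> \<one>" "s \<noteq> t"
    and generates: "generate G {s, b, t} = carrier G"
    and meets:
      "generate G {s, b} \<inter> generate G {b, t} \<subseteq> {\<one>, b}"
      "generate G {s, b} \<inter> generate G {s, t} \<subseteq> {\<one>, s}"
      "generate G {b, t} \<inter> generate G {s, t} \<subseteq> {\<one>, t}"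
begin

lemma cancel [simp]:
  assumes "x \<in> carrier G"
  shows "s \<otimes> (s \<otimes> x) = x" "b \<otimes> (b \<otimes> x) = x" "t \<otimes> (t \<otimes> x) = x"
  using assms by (simp_all add: m_assoc[symmetric])

lemma left_commute: "x \<in> carrier G \<Longrightarrow> t \<otimes> (s \<otimes> x) = s \<otimes> (t \<otimes> x)"
  using commute by (metis closed(1,3) m_assoc)

lemma inv_involutions [simp]: "inv s = s" "inv b = b" "inv t = t"
  using involutions closed by (auto intro: inv_equality)

lemma subgroups:
  "subgroup (generate G {s, b}) G" "subgroup (generate G {b, t}) G"
  "subgroup (generate G {s, t}) G"
  by (auto intro!: generate_is_subgroup)

lemma generate_st: "generate G {s, t} = {\<one>, s, t, s \<otimes> t}"
proof
  have "subgroup {\<one>, s, t, s \<otimes> t} G"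
    using commute
    by (intro subgroupI) (auto simp: m_assoc left_commute inv_mult_group)
  then show "generate G {s, t} \<subseteq> {\<one>, s, t, s \<otimes> t}"
    by (intro generate_subgroup_incl) auto
  show "{\<one>, s, t, s \<otimes> t} \<subseteq> generate G {s, t}"
    by (auto intro: generate.intros)
qed

lemma swap: "edge_involutions G t b s"
  using distinct generates meets commute
  by unfold_locales (auto simp: insert_commute)

text \<open>
  A residual property of edges: the neighbours of an edge \<open>z\<langle>s, t\<rangle>\<close> of the other two kinds are
  represented by \<open>z\<close> times a power of \<open>t\<close> and by \<open>z\<close> times a power of \<open>s\<close>, respectively. Since \<open>s\<close> and \<open>t\<close>
  commute, the product of the two powers represents both neighbours at once. Together with
  \<open>eq_if_same_cosets\<close> this identifies the flags of these three types with the elements of the group.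
\<close>

lemma common_representative:
  assumes "x \<in> carrier G" "y \<in> carrier G" "z \<in> carrier G"
    and xz: "(z <# generate G {s, t}) \<inter> (x <# generate G {s, b}) \<noteq> {}"
    and yz: "(z <# generate G {s, t}) \<inter> (y <# generate G {b, t}) \<noteq> {}"
  shows "\<exists>u \<in> carrier G. u <# generate G {s, b} = x <# generate G {s, b} \<and>
    u <# generate G {b, t} = y <# generate G {b, t} \<and>
    u <# generate G {s, t} = z <# generate G {s, t}"
proof -
  obtain p where p: "p \<in> {\<one>, s, t, s \<otimes> t}" "x <# generate G {s, b} = (z \<otimes> p) <# generate G {s, b}"
    using l_cosets_meet_obtain[OF subgroups(1,3) assms(3,1) xz] generate_st by metis
  obtain q where q: "q \<in> {\<one>, s, t, s \<otimes> t}" "y <# generate G {b, t} = (z \<otimes> q) <# generate G {b, t}"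
    using l_cosets_meet_obtain[OF subgroups(2,3) assms(3,2) yz] generate_st by metis
  have gens: "s \<in> generate G {s, b}" "t \<in> generate G {b, t}"
    by (auto intro: generate.incl)
  have "\<exists>p' \<in> {\<one>, t}. x <# generate G {s, b} = (z \<otimes> p') <# generate G {s, b}"
    using p(1)
  proof (elim insertE emptyE)
    assume "p = s \<otimes> t"
    then show ?thesis
      using p(2) l_coset_mult_right[OF subgroups(1) _ gens(1), of "z \<otimes> t"] assms(3) commute
      by (auto simp: m_assoc)
  qed (use p(2) l_coset_mult_right[OF subgroups(1) assms(3) gens(1)] assms(3) in auto)
  then obtain p' where p': "p' \<in> {\<one>, t}" "x <# generate G {s, b} = (z \<otimes> p') <# generate G {s, b}"
    by blast
  have "\<exists>q' \<in> {\<one>, s}. y <# generate G {b, t} = (z \<otimes> q') <# generate G {b, t}"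
    using q(1)
  proof (elim insertE emptyE)
    assume "q = s \<otimes> t"
    then show ?thesis
      using q(2) l_coset_mult_right[OF subgroups(2) _ gens(2), of "z \<otimes> s"] assms(3)
      by (auto simp: m_assoc)
  qed (use q(2) l_coset_mult_right[OF subgroups(2) assms(3) gens(2)] assms(3) in auto)
  then obtain q' where q': "q' \<in> {\<one>, s}" "y <# generate G {b, t} = (z \<otimes> q') <# generate G {b, t}"
    by blast
  have in_gen: "p' \<in> generate G {b, t}" "q' \<in> generate G {s, b}" "p' \<otimes> q' \<in> generate G {s, t}"
    and carr: "p' \<in> carrier G" "q' \<in> carrier G" and comm: "p' \<otimes> q' = q' \<otimes> p'"
    using p' q' commute by (auto intro: generate.intros)
  define u where "u = z \<otimes> (p' \<otimes> q')"
  have "u <# generate G {s, b} = x <# generate G {s, b}"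
    using l_coset_mult_right[OF subgroups(1) _ in_gen(2), of "z \<otimes> p'"] assms(3) carr p'(2)
    by (simp add: u_def m_assoc)
  moreover have "u <# generate G {b, t} = y <# generate G {b, t}"
    using l_coset_mult_right[OF subgroups(2) _ in_gen(1), of "z \<otimes> q'"] assms(3) carr q'(2)
    by (simp add: u_def m_assoc comm)
  moreover have "u <# generate G {s, t} = z <# generate G {s, t}"
    using l_coset_mult_right[OF subgroups(3) assms(3) in_gen(3)] by (simp add: u_def)
  moreover have "u \<in> carrier G"
    using assms(3) carr by (simp add: u_def)
  ultimately show ?thesis
    by blast
qed

lemma eq_if_same_cosets:
  assumes "x \<in> carrier G" "y \<in> carrier G"
    and "x <# generate G {s, b} = y <# generate G {s, b}"
    and "x <# generate G {b, t} = y <# generate G {b, t}"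
    and "x <# generate G {s, t} = y <# generate G {s, t}"
  shows "x = y"
proof -
  have "inv x \<otimes> y = \<one>"
    using assms meets(2,3) distinct(3) subgroups by (auto simp: l_coset_eq_iff)
  then show ?thesis
    using assms(1,2) by (metis inv_closed inv_equality inv_inv)
qed

text \<open>
  The generators are their own inverses, so every element of the group is a word in them and a map
  that is multiplicative for right factors among the generators is a homomorphism.
\<close>

lemma homI_generators:
  assumes carr: "\<And>x. x \<in> carrier G \<Longrightarrow> \<psi> x \<in> carrier G"
    and one: "\<psi> \<one> = \<one>"
    and step: "\<And>x g. x \<in> carrier G \<Longrightarrow> g \<in> {s, b, t} \<Longrightarrow> \<psi> (x \<otimes> g) = \<psi> x \<otimes> \<psi> g"
  shows "\<psi> \<in> hom G G"
proof (rule homI)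
  fix x y assume x: "x \<in> carrier G" and "y \<in> carrier G"
  then have "y \<in> generate G {s, b, t}"
    by (simp add: generates)
  then show "\<psi> (x \<otimes> y) = \<psi> x \<otimes> \<psi> y"
    using x
  proof (induction arbitrary: x rule: generate.induct)
    case one
    then show ?case using assms(2) carr by simp
  next
    case (incl h)
    then show ?case using step by simp
  next
    case (inv h)
    then have "inv h = h" by auto
    then show ?case using inv step by simp
  next
    case (eng h k)
    then have "h \<in> carrier G" "k \<in> carrier G"
      by (simp_all add: generates)
    then show ?case
      using eng carr by (simp add: m_assoc[symmetric])
  qed
qed (rule carr)

lemma isoI_generators:
  assumes hom: "\<psi> \<in> hom G G" and inj: "inj_on \<psi> (carrier G)"
    and img: "{s, b, t} \<subseteq> \<psi> ` {s, b, t}"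
  shows "\<psi> \<in> iso G G"
proof -
  interpret group_hom G G \<psi>
    using hom by unfold_locales
  have "carrier G \<subseteq> \<psi> ` carrier G"
  proof -
    have "generate G {s, b, t} \<subseteq> \<psi> ` carrier G"
      using img by (intro generate_subgroup_incl img_is_subgroup) auto
    then show ?thesis
      by (simp add: generates)
  qed
  then show ?thesis
    using hom inj by (auto simp: iso_def bij_betw_def)
qed

text \<open>
  The flags of the types \<open>i, k, j\<close> correspond to the elements of \<open>G\<close>, so the correlation induces a map \<open>\<phi>\<close>
  on \<open>G\<close>. The flags of \<open>x\<close> and \<open>xs\<close> differ only in the element of type \<open>j\<close>; hence those of \<open>\<phi>(x)\<close> and
  \<open>\<phi>(xs)\<close> differ only in the element of type \<open>i\<close>, and \<open>\<phi>(xs) = \<phi>(x)t\<close>. In the same way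
  \<open>\<phi>(xt) = \<phi>(x)s\<close> and \<open>\<phi>(xb) = \<phi>(x)b\<close>. Up to the left translation by \<open>\<phi>(1)\<close>, the map \<open>\<phi>\<close> is therefore an
  automorphism.
\<close>

lemma correlation_swap_imp_automorphism:
  fixes I :: "'i set" and H :: "'i \<Rightarrow> 'a set"
  defines "\<Gamma> \<equiv> coset_pregeometry G I H"
  assumes cor: "correlation \<Gamma> \<alpha>"
    and idx: "i \<in> I" "j \<in> I" "k \<in> I" "i \<noteq> k" "j \<noteq> k"
    and H: "H i = generate G {s, b}" "H j = generate G {b, t}" "H k = generate G {s, t}"
    and type_map: "maps_type \<Gamma> \<alpha> i j" "maps_type \<Gamma> \<alpha> j i" "maps_type \<Gamma> \<alpha> k k"
  shows "\<exists>\<phi> \<in> iso G G. \<phi> s = t \<and> \<phi> b = b \<and> \<phi> t = s"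
proof -
  have perm: "\<alpha> permutes elements \<Gamma>"
    and inc: "\<And>X Y. X \<in> elements \<Gamma> \<Longrightarrow> Y \<in> elements \<Gamma> \<Longrightarrow> incident \<Gamma> (\<alpha> X) (\<alpha> Y) = incident \<Gamma> X Y"
    using cor by (auto simp: correlation_def)
  have elem: "(l, x <# H l) \<in> elements \<Gamma>" if "l \<in> I" "x \<in> carrier G" for l x
    using that by (auto simp: \<Gamma>_def coset_pregeometry_def)
  have image: "\<exists>y \<in> carrier G. \<alpha> (l, x <# H l) = (m, y <# H m)"
    if "l \<in> I" "x \<in> carrier G" "maps_type \<Gamma> \<alpha> l m" for l m x
  proof -
    have "\<alpha> (l, x <# H l) \<in> elements \<Gamma>"
      using permutes_in_image[OF perm] elem that by blast
    moreover have "fst (\<alpha> (l, x <# H l)) = m"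
      using that elem[OF that(1,2)] by (auto simp: maps_type_def \<Gamma>_def coset_pregeometry_def)
    ultimately show ?thesis
      by (auto simp: \<Gamma>_def coset_pregeometry_def)
  qed
  have \<alpha>_inj: "\<alpha> X = \<alpha> Y \<Longrightarrow> X = Y" for X Y
    using permutes_inj[OF perm] by (simp add: inj_eq)
  have ex: "\<exists>u \<in> carrier G. \<alpha> (i, x <# H i) = (j, u <# H j) \<and>
      \<alpha> (j, x <# H j) = (i, u <# H i) \<and> \<alpha> (k, x <# H k) = (k, u <# H k)"
    if x: "x \<in> carrier G" for x
  proof -
    obtain y1 where y1: "y1 \<in> carrier G" "\<alpha> (i, x <# H i) = (j, y1 <# H j)"
      using image[OF idx(1) x type_map(1)] by blast
    obtain y2 where y2: "y2 \<in> carrier G" "\<alpha> (j, x <# H j) = (i, y2 <# H i)"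
      using image[OF idx(2) x type_map(2)] by blast
    obtain y3 where y3: "y3 \<in> carrier G" "\<alpha> (k, x <# H k) = (k, y3 <# H k)"
      using image[OF idx(3) x type_map(3)] by blast
    have meet: "(x <# H k) \<inter> (x <# H l) \<noteq> {}" if "l \<in> {i, j}" for l
      using l_cosets_meet[OF _ _ x, of "H l" "H k" \<one>] subgroups that H x
      by (auto simp: subgroup.one_closed)
    then have "incident \<Gamma> (k, x <# H k) (l, x <# H l)" if "l \<in> {i, j}" for l
      using that idx by (auto simp: \<Gamma>_def coset_pregeometry_def)
    then have "incident \<Gamma> (k, y3 <# H k) (j, y1 <# H j)" "incident \<Gamma> (k, y3 <# H k) (i, y2 <# H i)"
      using inc[OF elem elem, OF idx(3) x idx(1) x] inc[OF elem elem, OF idx(3) x idx(2) x] y1 y2 y3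
      by auto
    then show ?thesis
      using common_representative[OF y2(1) y1(1) y3(1)] y1 y2 y3 H
      by (auto simp: \<Gamma>_def coset_pregeometry_def)
  qed
  then obtain \<phi> where \<phi>: "\<And>x. x \<in> carrier G \<Longrightarrow> \<phi> x \<in> carrier G"
    "\<And>x. x \<in> carrier G \<Longrightarrow> \<alpha> (i, x <# H i) = (j, \<phi> x <# H j)"
    "\<And>x. x \<in> carrier G \<Longrightarrow> \<alpha> (j, x <# H j) = (i, \<phi> x <# H i)"
    "\<And>x. x \<in> carrier G \<Longrightarrow> \<alpha> (k, x <# H k) = (k, \<phi> x <# H k)"
    by metis
  have same: "\<phi> x <# H j = \<phi> y <# H j \<longleftrightarrow> x <# H i = y <# H i"
    "\<phi> x <# H i = \<phi> y <# H i \<longleftrightarrow> x <# H j = y <# H j"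
    "\<phi> x <# H k = \<phi> y <# H k \<longleftrightarrow> x <# H k = y <# H k"
    if "x \<in> carrier G" "y \<in> carrier G" for x y
    using \<phi>(2-4)[OF that(1)] \<phi>(2-4)[OF that(2)] \<alpha>_inj by (metis prod.inject)+
  have mem: "inv (\<phi> x) \<otimes> \<phi> y \<in> H j \<longleftrightarrow> x <# H i = y <# H i"
    "inv (\<phi> x) \<otimes> \<phi> y \<in> H i \<longleftrightarrow> x <# H j = y <# H j"
    "inv (\<phi> x) \<otimes> \<phi> y \<in> H k \<longleftrightarrow> x <# H k = y <# H k"
    if "x \<in> carrier G" "y \<in> carrier G" for x y
    using same[OF that] l_coset_eq_iff[OF _ \<phi>(1)[OF that(1)] \<phi>(1)[OF that(2)]] subgroups H
    by metis+
  have \<phi>_inj: "x = y" if "x \<in> carrier G" "y \<in> carrier G" "\<phi> x = \<phi> y" for x y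
    using same[OF that(1,2)] that eq_if_same_cosets H by metis
  have quot: "\<phi> (x \<otimes> g) = \<phi> x \<otimes> g'"
    if "x \<in> carrier G" "g \<in> carrier G" "g' \<in> carrier G" "inv (\<phi> x) \<otimes> \<phi> (x \<otimes> g) \<in> {\<one>, g'}" "g \<noteq> \<one>" for x g g'
  proof -
    have "inv (\<phi> x) \<otimes> \<phi> (x \<otimes> g) \<noteq> \<one>"
    proof
      assume "inv (\<phi> x) \<otimes> \<phi> (x \<otimes> g) = \<one>"
      then have "\<phi> (x \<otimes> g) = \<phi> x"
        using \<phi>(1) that by (metis inv_equality inv_inv inv_closed m_closed)
      then have "x \<otimes> g = x"
        using \<phi>_inj that by simp
      then show False
        using that by simp
    qed
    then have "inv (\<phi> x) \<otimes> \<phi> (x \<otimes> g) = g'"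
      using that(4) by blast
    moreover have "\<phi> (x \<otimes> g) = \<phi> x \<otimes> (inv (\<phi> x) \<otimes> \<phi> (x \<otimes> g))"
      using \<phi>(1) that(1,2) by (simp add: m_assoc[symmetric])
    ultimately show ?thesis
      by simp
  qed
  have step_s: "\<phi> (x \<otimes> s) = \<phi> x \<otimes> t" if x: "x \<in> carrier G" for x
  proof (rule quot)
    have "x <# H i = (x \<otimes> s) <# H i" "x <# H k = (x \<otimes> s) <# H k"
      using x by (simp_all add: H l_coset_mult_right[OF subgroups(1)] l_coset_mult_right[OF subgroups(3)] generate.incl)
    then show "inv (\<phi> x) \<otimes> \<phi> (x \<otimes> s) \<in> {\<one>, t}"
      using mem[OF x, of "x \<otimes> s"] x meets(3) by (auto simp: H)
  qed (use x distinct in auto)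
  have step_t: "\<phi> (x \<otimes> t) = \<phi> x \<otimes> s" if x: "x \<in> carrier G" for x
  proof (rule quot)
    have "x <# H j = (x \<otimes> t) <# H j" "x <# H k = (x \<otimes> t) <# H k"
      using x by (simp_all add: H l_coset_mult_right[OF subgroups(2)] l_coset_mult_right[OF subgroups(3)] generate.incl)
    then show "inv (\<phi> x) \<otimes> \<phi> (x \<otimes> t) \<in> {\<one>, s}"
      using mem[OF x, of "x \<otimes> t"] x meets(2) by (auto simp: H)
  qed (use x distinct in auto)
  have step_b: "\<phi> (x \<otimes> b) = \<phi> x \<otimes> b" if x: "x \<in> carrier G" for x
  proof (cases "b = \<one>")
    case False
    show ?thesis
    proof (rule quot)
      have "x <# H i = (x \<otimes> b) <# H i" "x <# H j = (x \<otimes> b) <# H j"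
        using x by (simp_all add: H l_coset_mult_right[OF subgroups(1)] l_coset_mult_right[OF subgroups(2)] generate.incl)
      then show "inv (\<phi> x) \<otimes> \<phi> (x \<otimes> b) \<in> {\<one>, b}"
        using mem[OF x, of "x \<otimes> b"] x meets(1) by (auto simp: H)
    qed (use x False in auto)
  qed (use x \<phi>(1) in simp)
  define \<psi> where "\<psi> x = inv (\<phi> \<one>) \<otimes> \<phi> x" for x
  have steps: "\<psi> (x \<otimes> s) = \<psi> x \<otimes> t" "\<psi> (x \<otimes> t) = \<psi> x \<otimes> s" "\<psi> (x \<otimes> b) = \<psi> x \<otimes> b"
    if "x \<in> carrier G" for x
    using that \<phi>(1) by (simp_all add: \<psi>_def step_s step_t step_b m_assoc)
  have one: "\<psi> \<one> = \<one>"
    using \<phi>(1) by (simp add: \<psi>_def)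
  have gens: "\<psi> s = t" "\<psi> t = s" "\<psi> b = b"
    using steps[of \<one>] one by simp_all
  have "\<psi> \<in> hom G G"
    by (rule homI_generators) (use \<phi>(1) one steps gens in \<open>auto simp: \<psi>_def\<close>)
  moreover have "inj_on \<psi> (carrier G)"
    using \<phi>(1) \<phi>_inj by (auto simp: inj_on_def \<psi>_def)
  ultimately have "\<psi> \<in> iso G G"
    by (rule isoI_generators) (use gens in auto)
  then show ?thesis
    using gens by blast
qed

text \<open>
  With \<open>K\<close> the stabiliser of an edge, this is the case of a vertex of valency at most two. The cosets
  \<open>gK\<close>, \<open>gbK\<close> and \<open>gsbK\<close> all meet \<open>g\<langle>s, b\<rangle>\<close>, and a coincidence among them says that a quotient of two
  of \<open>1, b, sb\<close> lies in \<open>K \<inter> \<langle>s, b\<rangle>\<close>, so it is \<open>1\<close> or \<open>s\<close>; every such equation implies \<open>sb = bs\<close>.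
\<close>

lemma commute_if_few_cosets:
  assumes "subgroup K G" "K \<inter> generate G {s, b} \<subseteq> {\<one>, s}" "g \<in> carrier G"
    and eq: "card {g <# K, (g \<otimes> b) <# K, (g \<otimes> (s \<otimes> b)) <# K} \<le> 2"
  shows "s \<otimes> b = b \<otimes> s"
proof -
  have pair: "inv x \<otimes> y \<in> {\<one>, s}" if "x \<in> {\<one>, b, s \<otimes> b}" "y \<in> {\<one>, b, s \<otimes> b}" "(g \<otimes> x) <# K = (g \<otimes> y) <# K" for x y
  proof -
    have gen: "x \<in> generate G {s, b}" "y \<in> generate G {s, b}"
      using that by (auto intro: generate.intros)
    then have xy: "x \<in> carrier G" "y \<in> carrier G"
      by (simp_all add: subgroup.mem_carrier[OF subgroups(1)])
    have "inv (g \<otimes> x) \<otimes> (g \<otimes> y) \<in> K"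
      using that xy assms by (simp add: l_coset_eq_iff)
    then have "inv x \<otimes> y \<in> K"
    proof -
      have "inv g \<otimes> (g \<otimes> y) = y"
        using xy assms(3) by (simp add: m_assoc[symmetric])
      then show ?thesis
        using \<open>inv (g \<otimes> x) \<otimes> (g \<otimes> y) \<in> K\<close> xy assms(3) by (simp add: inv_mult_group m_assoc)
    qed
    moreover have "inv x \<otimes> y \<in> generate G {s, b}"
      using gen subgroups(1) by (simp add: subgroup.m_closed subgroup.m_inv_closed)
    ultimately show ?thesis
      using assms(2) by blast
  qed
  consider "g <# K = (g \<otimes> b) <# K" | "g <# K = (g \<otimes> (s \<otimes> b)) <# K"
    | "(g \<otimes> b) <# K = (g \<otimes> (s \<otimes> b)) <# K"
    using eq by (auto simp: card_insert_if split: if_splits)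
  then show ?thesis
  proof cases
    case 1
    then have "b \<in> {\<one>, s}"
      using pair[of \<one> b] assms(3) by simp
    then show ?thesis by auto
  next
    case 2
    then have "s \<otimes> b \<in> {\<one>, s}"
      using pair[of \<one> "s \<otimes> b"] assms(3) by simp
    then have "b \<in> {s, \<one>}"
      using cancel(1)[OF closed(2)] by (metis closed(1) insert_iff involutions(1) r_one singletonD)
    then show ?thesis by auto
  next
    case 3
    then have "b \<otimes> (s \<otimes> b) \<in> {\<one>, s}"
      using pair[of b "s \<otimes> b"] by simp
    then have "s \<otimes> b \<in> {b, b \<otimes> s}"
      using cancel(2)[of "s \<otimes> b"]
      by (metis closed(1,2) insert_iff m_closed r_one singletonD)
    moreover have "s \<otimes> b \<noteq> b"
      using distinct(1) by simp
    ultimately show ?thesis by auto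
  qed
qed

text \<open>
  An edge is incident with at most two elements of any other type: its stabiliser has order four, and
  one of its involutions fixes the neighbour represented by \<open>g\<close>.
\<close>

lemma edge_neighbours:
  assumes "subgroup H G" "r \<in> H" "r \<in> {s, t, s \<otimes> t}" "g \<in> carrier G"
  shows "\<exists>q \<in> carrier G. \<forall>y \<in> carrier G. (g <# generate G {s, t}) \<inter> (y <# H) \<noteq> {} \<longrightarrow>
    y <# H \<in> {g <# H, (g \<otimes> q) <# H}"
proof -
  define q where "q = (if r = s then t else s)"
  have q: "q \<in> carrier G" "r \<in> carrier G" "r \<otimes> q = q \<otimes> r" and K: "generate G {s, t} = {\<one>, r, q, q \<otimes> r}"
    using assms(3) commute unfolding generate_st q_def by (auto simp: m_assoc left_commute)
  have "y <# H \<in> {g <# H, (g \<otimes> q) <# H}"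
    if y: "y \<in> carrier G" "(g <# generate G {s, t}) \<inter> (y <# H) \<noteq> {}" for y
  proof -
    obtain p where p: "p \<in> {\<one>, r, q, q \<otimes> r}" "y <# H = (g \<otimes> p) <# H"
      using l_cosets_meet_obtain[OF assms(1) subgroups(3) assms(4) y] K by metis
    have "(g \<otimes> r) <# H = g <# H" "(g \<otimes> (q \<otimes> r)) <# H = (g \<otimes> q) <# H"
      using l_coset_mult_right[OF assms(1) _ assms(2)] assms(4) q by (simp_all add: m_assoc[symmetric])
    then show ?thesis
      using p assms(4) by auto
  qed
  then show ?thesis
    using q(1) by blast
qed

text \<open>
  A correlation that sends \<open>x\<close> to an edge sends the edges at \<open>x\<close> to neighbours, all of one type, of that
  edge. There are at most two such neighbours, so \<open>x\<close> has valency at most two.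
\<close>

lemma commute_if_mapped_to_edge:
  fixes I :: "'i set" and H :: "'i \<Rightarrow> 'a set"
  defines "\<Gamma> \<equiv> coset_pregeometry G I H"
  assumes cor: "correlation \<Gamma> \<alpha>"
    and idx: "i \<in> I" "k \<in> I" "i \<noteq> k"
    and H: "H i = generate G {s, b}" "H k = generate G {s, t}"
    and sub: "\<And>j. j \<in> I \<Longrightarrow> subgroup (H j) G"
    and meet: "\<And>j. j \<in> I \<Longrightarrow> H j \<inter> {s, t, s \<otimes> t} \<noteq> {}"
    and x: "x \<in> elements \<Gamma>" "type_of \<Gamma> x = i" "type_of \<Gamma> (\<alpha> x) = k"
  shows "s \<otimes> b = b \<otimes> s"
proof -
  have perm: "\<alpha> permutes elements \<Gamma>"
    and type_map: "\<And>X Y. X \<in> elements \<Gamma> \<Longrightarrow> Y \<in> elements \<Gamma> \<Longrightarrow>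
      type_of \<Gamma> X = type_of \<Gamma> Y \<Longrightarrow> type_of \<Gamma> (\<alpha> X) = type_of \<Gamma> (\<alpha> Y)"
    and inc: "\<And>X Y. X \<in> elements \<Gamma> \<Longrightarrow> Y \<in> elements \<Gamma> \<Longrightarrow> incident \<Gamma> X Y \<Longrightarrow> incident \<Gamma> (\<alpha> X) (\<alpha> Y)"
    using cor by (auto simp: correlation_def)
  obtain g where g: "g \<in> carrier G" "x = (i, g <# H i)"
    using x by (auto simp: \<Gamma>_def coset_pregeometry_def)
  have "\<alpha> x \<in> elements \<Gamma>"
    using permutes_in_image[OF perm] x(1) by blast
  then obtain z where z: "z \<in> carrier G" "\<alpha> x = (k, z <# H k)"
    using x(3) by (auto simp: \<Gamma>_def coset_pregeometry_def)
  define N where "N = (\<lambda>p. (k, (g \<otimes> p) <# H k)) ` {\<one>, b, s \<otimes> b}"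
  have N: "y \<in> elements \<Gamma> \<and> type_of \<Gamma> y = k \<and> incident \<Gamma> x y" if "y \<in> N" for y
  proof -
    from that obtain p where p: "p \<in> {\<one>, b, s \<otimes> b}" "y = (k, (g \<otimes> p) <# H k)"
      unfolding N_def by (rule imageE)
    then have gen: "p \<in> H i"
      by (auto simp: H intro: generate.intros)
    then have "p \<in> carrier G"
      by (rule subgroup.mem_carrier[OF sub[OF idx(1)]])
    moreover have "((g \<otimes> p) <# H k) \<inter> (g <# H i) \<noteq> {}"
      by (rule l_cosets_meet[OF sub[OF idx(1)] sub[OF idx(2)] g(1) gen])
    ultimately show ?thesis
      using p(2) g idx by (auto simp: \<Gamma>_def coset_pregeometry_def)
  qed
  define j where "j = type_of \<Gamma> (\<alpha> (k, g <# H k))"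
  have "(k, g <# H k) \<in> N"
    using g(1) by (force simp: N_def)
  then have Nj: "\<alpha> y \<in> elements \<Gamma> \<and> type_of \<Gamma> (\<alpha> y) = j \<and> incident \<Gamma> (\<alpha> x) (\<alpha> y)" if "y \<in> N" for y
    using N[OF that] N[of "(k, g <# H k)"] type_map[of y "(k, g <# H k)"] inc[OF x(1)] that
      permutes_in_image[OF perm] by (auto simp: j_def)
  then have jI: "j \<in> I"
    using \<open>(k, g <# H k) \<in> N\<close> by (force simp: \<Gamma>_def coset_pregeometry_def)
  obtain r where "r \<in> H j" "r \<in> {s, t, s \<otimes> t}"
    using meet[OF jI] by blast
  then obtain q where q: "\<forall>y \<in> carrier G. (z <# generate G {s, t}) \<inter> (y <# H j) \<noteq> {} \<longrightarrow>
    y <# H j \<in> {z <# H j, (z \<otimes> q) <# H j}"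
    using edge_neighbours[OF sub[OF jI] _ _ z(1)] by blast
  have "\<alpha> ` N \<subseteq> {(j, z <# H j), (j, (z \<otimes> q) <# H j)}"
  proof
    fix Y assume "Y \<in> \<alpha> ` N"
    then have Y: "Y \<in> elements \<Gamma>" "type_of \<Gamma> Y = j" "incident \<Gamma> (k, z <# H k) Y"
      using Nj z by auto
    from Y(1,2) obtain y where "y \<in> carrier G" "Y = (j, y <# H j)"
      by (auto simp: \<Gamma>_def coset_pregeometry_def)
    then show "Y \<in> {(j, z <# H j), (j, (z \<otimes> q) <# H j)}"
      using q Y(3) H(2) by (auto simp: \<Gamma>_def coset_pregeometry_def)
  qed
  then have "card (\<alpha> ` N) \<le> card {(j, z <# H j), (j, (z \<otimes> q) <# H j)}"
    by (intro card_mono) auto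
  also have "\<dots> \<le> 2"
    by (simp add: card_insert_if)
  finally have "card N \<le> 2"
    using card_image[of \<alpha> N] permutes_inj_on[OF perm, of N] by simp
  moreover have "N = Pair k ` {g <# H k, (g \<otimes> b) <# H k, (g \<otimes> (s \<otimes> b)) <# H k}"
    using g(1) by (auto simp: N_def)
  ultimately have "card {g <# H k, (g \<otimes> b) <# H k, (g \<otimes> (s \<otimes> b)) <# H k} \<le> 2"
    by (metis (no_types, lifting) card_image inj_onI prod.inject)
  then show ?thesis
    using commute_if_few_cosets[OF sub[OF idx(2)] _ g(1)] meets(2) H
    by (simp add: Int_commute)
qed

text \<open>
  If \<open>b\<close> is central, then so are \<open>s\<close> and \<open>t\<close>, and \<open>G\<close> is elementary abelian. The subgroup \<open>K = \<langle>b, st\<rangle>\<close> has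
  index two and contains neither \<open>s\<close> nor \<open>t\<close>. Multiplying the elements outside \<open>K\<close> by \<open>st\<close> is then an
  automorphism, and it exchanges \<open>s\<close> and \<open>t\<close>.
\<close>

lemma abelian_imp_swap:
  assumes sb: "s \<otimes> b = b \<otimes> s" and tb: "t \<otimes> b = b \<otimes> t"
    and meet: "generate G {b, s \<otimes> t} \<inter> generate G {s, t} \<subseteq> {\<one>, s \<otimes> t}"
  shows "\<exists>\<phi> \<in> iso G G. \<phi> s = t \<and> \<phi> b = b \<and> \<phi> t = s"
proof -
  define K where "K = generate G {b, s \<otimes> t}"
  have K: "subgroup K G"
    unfolding K_def by (intro generate_is_subgroup) auto
  have in_K: "b \<in> K" "s \<otimes> t \<in> K"
    by (auto simp: K_def intro: generate.incl)
  have not_in_K: "s \<notin> K" "t \<notin> K"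
    using meet distinct generate.incl[of s "{s, t}" G] generate.incl[of t "{s, t}" G]
    by (auto simp: K_def)
  define \<phi> where "\<phi> x = (if x \<in> K then x else x \<otimes> (s \<otimes> t))" for x
  have Kr: "x \<otimes> k \<in> K \<longleftrightarrow> x \<in> K" if "k \<in> K" "x \<in> carrier G" for x k
  proof
    assume "x \<otimes> k \<in> K"
    then have "(x \<otimes> k) \<otimes> inv k \<in> K"
      using that K by (simp add: subgroup.m_closed subgroup.m_inv_closed)
    moreover have "k \<in> carrier G"
      by (rule subgroup.mem_carrier[OF K that(1)])
    ultimately show "x \<in> K"
      using that by (simp add: m_assoc)
  qed (use that K in \<open>auto simp: subgroup.m_closed\<close>)
  have central: "s \<otimes> x = x \<otimes> s" if "x \<in> carrier G" for x
    using that[folded generates]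
  proof (induction rule: generate.induct)
    case (eng h k)
    then have "h \<in> carrier G" "k \<in> carrier G"
      by (simp_all add: generates)
    then show ?case
      using eng closed(1) by (metis m_assoc)
  qed (use sb commute in auto)
  have index: "x \<in> K \<or> x \<otimes> s \<in> K" if "x \<in> carrier G" for x
    using that[folded generates]
  proof (induction rule: generate.induct)
    case (eng h k)
    then have hk: "h \<in> carrier G" "k \<in> carrier G"
      by (simp_all add: generates)
    have "(h \<otimes> s) \<otimes> k = (h \<otimes> k) \<otimes> s" "(h \<otimes> s) \<otimes> (k \<otimes> s) = h \<otimes> k" "h \<otimes> (k \<otimes> s) = (h \<otimes> k) \<otimes> s"
      using hk central[of k, symmetric] by (simp_all add: m_assoc)
    then show ?case
      using eng.IH subgroup.m_closed[OF K] by metis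
  qed (use in_K K in \<open>auto simp: subgroup.one_closed commute\<close>)
  have st_carr: "s \<otimes> t \<in> carrier G" by simp
  have xs: "x \<otimes> s \<in> K \<longleftrightarrow> x \<notin> K" if "x \<in> carrier G" for x
    using index[OF that] that not_in_K(1) K
    by (metis closed(1) inv_closed l_inv l_one m_assoc subgroup.m_closed subgroup.m_inv_closed)
  have xt: "x \<otimes> t \<in> K \<longleftrightarrow> x \<notin> K" if "x \<in> carrier G" for x
    using xs[OF that] Kr[OF in_K(2), of "x \<otimes> s"] that by (simp add: m_assoc)
  have b_st: "b \<otimes> (s \<otimes> t) = s \<otimes> (b \<otimes> t)"
    using sb by (simp add: m_assoc[symmetric])
  have "\<phi> \<in> hom G G"
  proof (rule homI_generators)
    fix x g assume x: "x \<in> carrier G" and g: "g \<in> {s, b, t}"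
    then show "\<phi> (x \<otimes> g) = \<phi> x \<otimes> \<phi> g"
      using not_in_K in_K xs[OF x] xt[OF x] Kr[OF in_K(1) x] commute sb tb left_commute b_st
      by (auto simp: \<phi>_def m_assoc)
  qed (use K in \<open>auto simp: \<phi>_def subgroup.one_closed\<close>)
  moreover have "inj_on \<phi> (carrier G)"
  proof (rule inj_onI)
    fix x y assume "x \<in> carrier G" "y \<in> carrier G" "\<phi> x = \<phi> y"
    then show "x = y"
      using Kr[OF in_K(2)] st_carr by (auto simp: \<phi>_def split: if_splits)
  qed
  moreover have \<phi>_gens: "\<phi> s = t" "\<phi> b = b" "\<phi> t = s"
    using not_in_K in_K commute by (auto simp: \<phi>_def left_commute)
  ultimately have "\<phi> \<in> iso G G"
    by (intro isoI_generators) auto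
  then show ?thesis
    using \<phi>_gens by blast
qed

end

section \<open>Automorphisms of maps of Class III\<close>

text \<open>
  The isomorphism class of \<open>(a, b, c)\<close> consists of the Wilson images reached by automorphisms that
  fix \<open>b\<close> and permute \<open>a, c, ac\<close>, so its size is the order of a group of permutations of three points.
  Order three leaves only the cyclic group: among two elements other than the identity there is a 3-cycle,
  because two distinct transpositions compose to one, and the 3-cycles, being squares of each
  other, occur together and leave no room for a transposition.
\<close>

lemma (in group) class_III_automorphisms:
  assumes closed [simp]: "a \<in> carrier G" "b \<in> carrier G" "c \<in> carrier G"
    and invol [simp]: "a \<otimes> a = \<one>" "c \<otimes> c = \<one>" and comm: "c \<otimes> a = a \<otimes> c"
    and dist: "a \<noteq> \<one>" "c \<noteq> \<one>" "a \<noteq> c"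
    and III: "class_III G (a, b, c)"
  shows "\<exists>\<tau> \<in> iso G G. \<tau> a = c \<and> \<tau> b = b \<and> \<tau> c = a \<otimes> c"
    and "\<not> (\<exists>\<phi> \<in> iso G G. \<phi> a = c \<and> \<phi> b = b \<and> \<phi> c = a)"
    and "\<not> (\<exists>\<phi> \<in> iso G G. \<phi> a = a \<otimes> c \<and> \<phi> b = b \<and> \<phi> c = c)"
    and "\<not> (\<exists>\<phi> \<in> iso G G. \<phi> a = a \<and> \<phi> b = b \<and> \<phi> c = a \<otimes> c)"
proof -
  have assoc: "a \<otimes> (a \<otimes> x) = x" "c \<otimes> (c \<otimes> x) = x" "c \<otimes> (a \<otimes> x) = a \<otimes> (c \<otimes> x)"
    if "x \<in> carrier G" for x
    using that comm by (simp_all add: m_assoc[symmetric])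
  have mult: "(a \<otimes> c) \<otimes> c = a" "(a \<otimes> c) \<otimes> a = c" "a \<otimes> (a \<otimes> c) = c" "c \<otimes> (a \<otimes> c) = a"
    using comm by (simp_all add: m_assoc assoc)
  have ne: "a \<otimes> c \<noteq> a" "a \<otimes> c \<noteq> c"
    using dist by simp_all
  (* D, P and Q are the images under the three operations of order two, R and R' those under the
     two operations of order three. *)
  define \<rho> D P Q R R' where defs: "\<rho> = (a, b, c)" "D = (c, b, a)" "P = (a \<otimes> c, b, c)"
    "Q = (a, b, a \<otimes> c)" "R = (c, b, a \<otimes> c)" "R' = (a \<otimes> c, b, a)"
  have distinct: "distinct [\<rho>, D, P, Q, R, R']"
    using dist ne by (auto simp: defs)
  have W: "wilson_images G \<rho> \<subseteq> {\<rho>, D, P, Q, R, R'}"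
  proof
    fix x assume "x \<in> wilson_images G \<rho>"
    then show "x \<in> {\<rho>, D, P, Q, R, R'}"
      by induction (auto simp: defs dual_op_def petrie_op_def mult comm)
  qed
  have in_W: "\<rho> \<in> wilson_images G \<rho>" "R \<in> wilson_images G \<rho>" "R' \<in> wilson_images G \<rho>"
  proof -
    show \<rho>: "\<rho> \<in> wilson_images G \<rho>"
      by (rule wilson_images.self)
    show "R \<in> wilson_images G \<rho>"
      using wilson_images.dual[OF wilson_images.petrie[OF \<rho>]]
      by (simp add: defs dual_op_def petrie_op_def)
    show "R' \<in> wilson_images G \<rho>"
      using wilson_images.petrie[OF wilson_images.dual[OF \<rho>]]
      by (simp add: defs dual_op_def petrie_op_def comm)
  qed
  define A where "A x y \<longleftrightarrow> (\<exists>h \<in> iso G G. h a = x \<and> h b = b \<and> h c = y)" for x y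
  have A_iff: "triple_iso G \<rho> G (x, b, y) \<longleftrightarrow> A x y" for x y
    by (auto simp: triple_iso_def A_def defs)
  have id: "A a c"
    unfolding A_def by (rule bexI[OF _ id_iso]) simp
  define C where "C = {w \<in> wilson_images G \<rho>. triple_iso G \<rho> G w}"
  have "C \<in> wilson_images G \<rho> //
      {(x, y). x \<in> wilson_images G \<rho> \<and> y \<in> wilson_images G \<rho> \<and> triple_iso G x G y}"
    using quotientI[OF in_W(1), of "{(x, y). x \<in> wilson_images G \<rho> \<and> y \<in> wilson_images G \<rho> \<and> triple_iso G x G y}"]
      in_W(1) by (simp add: C_def Image_def)
  then have card_C: "card C = 3"
    using III by (simp add: class_III_def Let_def defs)
  have comp: "\<exists>g \<in> iso G G. g a = k (h a) \<and> g b = b \<and> g c = k (h c)"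
    if "h \<in> iso G G" "k \<in> iso G G" "h b = b" "k b = b" for h k
    using iso_set_trans[OF that(1,2)] that(3,4) by (intro bexI[of _ "k \<circ> h"]) auto
  (* Composition: the conditionals are the values at x and y of the automorphism with
     a \<mapsto> x' and c \<mapsto> y'. *)
  have A_comp: "A (if x = a then x' else if x = c then y' else x' \<otimes> y')
      (if y = a then x' else if y = c then y' else x' \<otimes> y')"
    if "A x y" "A x' y'" "x \<in> {a, c, a \<otimes> c}" "y \<in> {a, c, a \<otimes> c}" for x y x' y'
  proof -
    obtain h k where hk: "h \<in> iso G G" "h a = x" "h b = b" "h c = y"
      "k \<in> iso G G" "k a = x'" "k b = b" "k c = y'"
      using \<open>A x y\<close> \<open>A x' y'\<close> by (auto simp: A_def)
    have "k (a \<otimes> c) = x' \<otimes> y'"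
      using hk by (auto simp: iso_def hom_mult)
    then have "k x = (if x = a then x' else if x = c then y' else x' \<otimes> y')"
      "k y = (if y = a then x' else if y = c then y' else x' \<otimes> y')"
      using that(3,4) hk by auto
    then show ?thesis
      using comp[OF hk(1,5,3,7)] hk by (auto simp: A_def)
  qed
  have R_R': "A c (a \<otimes> c) \<longleftrightarrow> A (a \<otimes> c) a"
    using A_comp[of c "a \<otimes> c" c "a \<otimes> c"] A_comp[of "a \<otimes> c" a "a \<otimes> c" a] dist ne mult by auto
  have two: "A c a \<Longrightarrow> A (a \<otimes> c) c \<Longrightarrow> A c (a \<otimes> c)"
    "A c a \<Longrightarrow> A a (a \<otimes> c) \<Longrightarrow> A (a \<otimes> c) a"
    "A (a \<otimes> c) c \<Longrightarrow> A a (a \<otimes> c) \<Longrightarrow> A c (a \<otimes> c)"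
    using A_comp[of c a "a \<otimes> c" c] A_comp[of c a a "a \<otimes> c"] A_comp[of "a \<otimes> c" c a "a \<otimes> c"] dist ne mult
    by auto
  have C_sub: "w \<in> {\<rho>, D, P, Q, R, R'} \<and> (w = D \<longrightarrow> A c a) \<and> (w = P \<longrightarrow> A (a \<otimes> c) c) \<and>
      (w = Q \<longrightarrow> A a (a \<otimes> c)) \<and> (w = R \<longrightarrow> A c (a \<otimes> c)) \<and> (w = R' \<longrightarrow> A (a \<otimes> c) a)" if "w \<in> C" for w
    using that W A_iff by (auto simp: C_def defs)
  show \<tau>: "\<exists>\<tau> \<in> iso G G. \<tau> a = c \<and> \<tau> b = b \<and> \<tau> c = a \<otimes> c"
  proof (rule ccontr)
    assume "\<not> ?thesis"
    then have "\<not> A c (a \<otimes> c)" "\<not> A (a \<otimes> c) a"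
      using R_R' by (auto simp: A_def)
    then have "\<exists>T. C \<subseteq> {\<rho>, T}"
      using two C_sub by blast
    then obtain T where "C \<subseteq> {\<rho>, T}" ..
    then have "card C \<le> card {\<rho>, T}"
      by (intro card_mono) auto
    also have "\<dots> \<le> 2"
      by (simp add: card_insert_if)
    finally show False
      using card_C by simp
  qed
  then have "A c (a \<otimes> c)" "A (a \<otimes> c) a"
    using R_R' by (auto simp: A_def)
  then have "{\<rho>, R, R'} \<subseteq> C"
    using in_W id A_iff by (auto simp: C_def defs)
  moreover have "card {\<rho>, R, R'} = 3"
    using distinct by simp
  moreover have "finite C"
    using card_C card.infinite by fastforce
  ultimately have C: "C = {\<rho>, R, R'}"
    using card_C by (metis card_subset_eq)
  have all_in_W: "D \<in> wilson_images G \<rho>" "P \<in> wilson_images G \<rho>" "Q \<in> wilson_images G \<rho>"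
  proof -
    show D: "D \<in> wilson_images G \<rho>"
      using wilson_images.dual[OF in_W(1)] by (simp add: defs dual_op_def)
    show "P \<in> wilson_images G \<rho>"
      using wilson_images.petrie[OF in_W(1)] by (simp add: defs petrie_op_def)
    show "Q \<in> wilson_images G \<rho>"
      using wilson_images.dual[OF in_W(3)] by (simp add: defs dual_op_def)
  qed
  have "D \<notin> C" "P \<notin> C" "Q \<notin> C"
    using distinct by (auto simp: C)
  then have "\<not> A c a" "\<not> A (a \<otimes> c) c" "\<not> A a (a \<otimes> c)"
    using all_in_W A_iff by (auto simp: C_def defs)
  then show "\<not> (\<exists>\<phi> \<in> iso G G. \<phi> a = c \<and> \<phi> b = b \<and> \<phi> c = a)"
    "\<not> (\<exists>\<phi> \<in> iso G G. \<phi> a = a \<otimes> c \<and> \<phi> b = b \<and> \<phi> c = c)"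
    "\<not> (\<exists>\<phi> \<in> iso G G. \<phi> a = a \<and> \<phi> b = b \<and> \<phi> c = a \<otimes> c)"
    by (auto simp: A_def)
qed

section \<open>Correlations induced by automorphisms\<close>

lemma (in group) automorphism_image_l_coset:
  assumes "\<tau> \<in> hom G G" "g \<in> carrier G" "H \<subseteq> carrier G"
  shows "\<tau> ` (g <# H) = \<tau> g <# (\<tau> ` H)"
  using assms by (force simp: l_coset_def hom_mult subset_iff)

lemma (in group) automorphism_induces_correlation:
  fixes I :: "'i set" and H :: "'i \<Rightarrow> 'a set"
  defines "\<Gamma> \<equiv> coset_pregeometry G I H"
  assumes \<tau>: "\<tau> \<in> iso G G" and \<pi>: "bij_betw \<pi> I I"
    and H: "\<And>i. i \<in> I \<Longrightarrow> H i \<subseteq> carrier G" "\<And>i. i \<in> I \<Longrightarrow> \<tau> ` H i = H (\<pi> i)"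
  shows "correlation \<Gamma> (\<lambda>x. if x \<in> elements \<Gamma> then map_prod \<pi> ((`) \<tau>) x else x)"
proof -
  define \<alpha> where "\<alpha> x = (if x \<in> elements \<Gamma> then map_prod \<pi> ((`) \<tau>) x else x)" for x
  have hom: "\<tau> \<in> hom G G" and inj: "inj_on \<tau> (carrier G)" and surj: "\<tau> ` carrier G = carrier G"
    using \<tau> by (auto simp: iso_def bij_betw_def)
  have image: "\<alpha> (i, g <# H i) = (\<pi> i, \<tau> g <# H (\<pi> i))" if "i \<in> I" "g \<in> carrier G" for i g
    using that automorphism_image_l_coset[OF hom that(2) H(1)[OF that(1)]] H(2)
    by (auto simp: \<alpha>_def \<Gamma>_def coset_pregeometry_def)
  have sub: "snd x \<subseteq> carrier G" "fst x \<in> I" if "x \<in> elements \<Gamma>" for x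
    using that H(1) by (auto simp: \<Gamma>_def coset_pregeometry_def l_coset_def subset_iff)
  have "inj_on \<alpha> (elements \<Gamma>)"
  proof (rule inj_onI)
    fix x y assume xy: "x \<in> elements \<Gamma>" "y \<in> elements \<Gamma>" "\<alpha> x = \<alpha> y"
    then have "\<pi> (fst x) = \<pi> (fst y)" "\<tau> ` snd x = \<tau> ` snd y"
      by (auto simp: \<alpha>_def map_prod_def split: prod.splits)
    moreover have "inj_on \<pi> I"
      using \<pi> by (simp add: bij_betw_def)
    ultimately have "fst x = fst y" "snd x = snd y"
      using sub[OF xy(1)] sub[OF xy(2)] inj_on_image_eq_iff[OF inj, of "snd x" "snd y"]
      by (blast dest: inj_onD)+
    then show "x = y"
      by (rule prod_eqI)
  qed
  moreover have "\<alpha> ` elements \<Gamma> = elements \<Gamma>"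
  proof
    have "\<pi> i \<in> I" if "i \<in> I" for i
      using that \<pi> by (auto simp: bij_betw_def)
    then show "\<alpha> ` elements \<Gamma> \<subseteq> elements \<Gamma>"
      using image hom by (fastforce simp: \<Gamma>_def coset_pregeometry_def hom_in_carrier)
    show "elements \<Gamma> \<subseteq> \<alpha> ` elements \<Gamma>"
    proof
      fix y assume "y \<in> elements \<Gamma>"
      then obtain j h where y: "j \<in> I" "h \<in> carrier G" "y = (j, h <# H j)"
        by (auto simp: \<Gamma>_def coset_pregeometry_def)
      obtain i where i: "i \<in> I" "j = \<pi> i"
        using y(1) \<pi> unfolding bij_betw_def by blast
      obtain g where g: "g \<in> carrier G" "h = \<tau> g"
        using y(2) surj by blast
      have "(i, g <# H i) \<in> elements \<Gamma>"
        using i g by (auto simp: \<Gamma>_def coset_pregeometry_def)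
      then show "y \<in> \<alpha> ` elements \<Gamma>"
        using image[OF i(1) g(1)] y i g by (metis imageI)
    qed
  qed
  ultimately have "bij_betw \<alpha> (elements \<Gamma>) (elements \<Gamma>)"
    by (simp add: bij_betw_def)
  then have "\<alpha> permutes elements \<Gamma>"
    by (rule bij_imp_permutes) (simp add: \<alpha>_def)
  moreover have "type_of \<Gamma> x = type_of \<Gamma> y \<longleftrightarrow> type_of \<Gamma> (\<alpha> x) = type_of \<Gamma> (\<alpha> y)"
    "incident \<Gamma> x y \<longleftrightarrow> incident \<Gamma> (\<alpha> x) (\<alpha> y)"
    if xy: "x \<in> elements \<Gamma>" "y \<in> elements \<Gamma>" for x y
  proof -
    have type_iff: "fst x = fst y \<longleftrightarrow> \<pi> (fst x) = \<pi> (fst y)"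
      using sub(2)[OF xy(1)] sub(2)[OF xy(2)] \<pi> by (auto simp: bij_betw_def inj_on_eq_iff)
    then show "type_of \<Gamma> x = type_of \<Gamma> y \<longleftrightarrow> type_of \<Gamma> (\<alpha> x) = type_of \<Gamma> (\<alpha> y)"
      using xy by (simp add: \<alpha>_def) (simp add: \<Gamma>_def coset_pregeometry_def)
    have "\<tau> ` snd x \<inter> \<tau> ` snd y = {} \<longleftrightarrow> snd x \<inter> snd y = {}"
      using inj_on_image_Int[OF inj sub(1)[OF xy(1)] sub(1)[OF xy(2)]] by (metis image_is_empty)
    moreover have "incident \<Gamma> u w \<longleftrightarrow> fst u \<noteq> fst w \<and> snd u \<inter> snd w \<noteq> {}" for u w
      by (simp add: \<Gamma>_def coset_pregeometry_def split: prod.splits)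
    ultimately show "incident \<Gamma> x y \<longleftrightarrow> incident \<Gamma> (\<alpha> x) (\<alpha> y)"
      using xy type_iff by (simp add: \<alpha>_def)
  qed
  ultimately have "correlation \<Gamma> \<alpha>"
    by (simp add: correlation_def)
  then show ?thesis
    by (simp add: \<alpha>_def[abs_def])
qed

section \<open>Trialities and dualities\<close>

lemma (in group) edge_involutions_image:
  assumes "edge_involutions G s b t" "\<tau> \<in> iso G G"
  shows "edge_involutions G (\<tau> s) (\<tau> b) (\<tau> t)"
proof -
  interpret E: edge_involutions G s b t
    by (rule assms)
  interpret \<tau>: group_hom G G \<tau>
    using assms(2) by unfold_locales (simp add: iso_def)
  have inj: "inj_on \<tau> (carrier G)" and surj: "\<tau> ` carrier G = carrier G"
    using assms(2) by (auto simp: iso_def bij_betw_def)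
  have gen: "generate G {\<tau> x, \<tau> y} = \<tau> ` generate G {x, y}" if "x \<in> carrier G" "y \<in> carrier G" for x y
    using \<tau>.generate_img[of "{x, y}"] that by simp
  have meet: "generate G {\<tau> x, \<tau> y} \<inter> generate G {\<tau> u, \<tau> v} \<subseteq> {\<one>, \<tau> z}"
    if "x \<in> carrier G" "y \<in> carrier G" "u \<in> carrier G" "v \<in> carrier G"
      "generate G {x, y} \<inter> generate G {u, v} \<subseteq> {\<one>, z}" for x y u v z
  proof -
    have "\<tau> ` (generate G {x, y} \<inter> generate G {u, v}) =
        \<tau> ` generate G {x, y} \<inter> \<tau> ` generate G {u, v}"
      using that by (intro inj_on_image_Int[OF inj]) (auto intro!: generate_incl)
    then show ?thesis
      using that(5) image_mono[OF that(5), of \<tau>] that(1-4) by (simp add: gen)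
  qed
  have ne: "\<tau> x \<noteq> \<tau> y" if "x \<in> carrier G" "y \<in> carrier G" "x \<noteq> y" for x y
    using inj_onD[OF inj] that by blast
  show ?thesis
  proof unfold_locales
    show "\<tau> s \<otimes> \<tau> s = \<one>" "\<tau> b \<otimes> \<tau> b = \<one>" "\<tau> t \<otimes> \<tau> t = \<one>" "\<tau> t \<otimes> \<tau> s = \<tau> s \<otimes> \<tau> t"
      by (simp_all add: E.commute flip: \<tau>.hom_mult)
    show "\<tau> s \<noteq> \<one>" "\<tau> t \<noteq> \<one>" "\<tau> s \<noteq> \<tau> t"
      using ne[of s \<one>] ne[of t \<one>] ne[of s t] E.distinct by simp_all
    show "generate G {\<tau> s, \<tau> b, \<tau> t} = carrier G"
      using \<tau>.generate_img[of "{s, b, t}"] E.generates surj by simp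
    show "generate G {\<tau> s, \<tau> b} \<inter> generate G {\<tau> b, \<tau> t} \<subseteq> {\<one>, \<tau> b}"
      by (rule meet) (use E.meets in simp_all)
    show "generate G {\<tau> s, \<tau> b} \<inter> generate G {\<tau> s, \<tau> t} \<subseteq> {\<one>, \<tau> s}"
      by (rule meet) (use E.meets in simp_all)
    show "generate G {\<tau> b, \<tau> t} \<inter> generate G {\<tau> s, \<tau> t} \<subseteq> {\<one>, \<tau> t}"
      by (rule meet) (use E.meets in simp_all)
  qed simp_all
qed

lemma (in edge_involutions) hom_id_on_generators:
  assumes "\<phi> \<in> hom G G" "\<phi> s = s" "\<phi> b = b" "\<phi> t = t" "x \<in> carrier G"
  shows "\<phi> x = x"
proof -
  interpret \<phi>: group_hom G G \<phi>
    using assms(1) by unfold_locales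
  show ?thesis
    using assms(5)[folded generates]
  proof (induction rule: generate.induct)
    case (eng h k)
    then show ?case
      using \<phi>.hom_mult[of h k] by (simp add: generates)
  qed (use assms in auto)
qed

text \<open>
  The triality is the correlation induced by the automorphism \<open>\<tau>\<close> with \<open>s \<mapsto> t \<mapsto> st \<mapsto> s\<close>. Through \<open>\<tau>\<close> the
  independence of the parabolic subgroups, assumed for the pair \<open>(s, t)\<close>, is available for the
  pairs \<open>(t, st)\<close> and \<open>(st, s)\<close> as well, so that the fourth type is on the same footing as the others.

  Edges cannot be exchanged with another type, since some, and by \<open>\<tau>\<close> every, involution in
  \<open>\<langle>s, t\<rangle>\<close> would commute with \<open>b\<close>, and \<open>abelian_imp_swap\<close> would give a forbidden automorphism. A duality
  therefore preserves the edges and exchanges two of the other three types, which again gives a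
  forbidden automorphism, by \<open>correlation_swap_imp_automorphism\<close>.
\<close>

theorem (in edge_involutions) class_III_triality_no_duality:
  assumes "class_III G (s, b, t)"
  shows "\<exists>\<alpha>. triality (wilson_pregeometry G (s, b, t)) \<alpha>"
    and "\<not> (\<exists>\<alpha>. duality (wilson_pregeometry G (s, b, t)) \<alpha>)"
proof -
  note aut = class_III_automorphisms[OF closed involutions(1,3) commute distinct assms]
  obtain \<tau> where \<tau>: "\<tau> \<in> iso G G" "\<tau> s = t" "\<tau> b = b" "\<tau> t = s \<otimes> t"
    using aut(1) by blast
  then have hom: "\<tau> \<in> hom G G"
    by (simp add: iso_def)
  interpret \<tau>: group_hom G G \<tau>
    using hom by unfold_locales
  have products: "t \<otimes> (s \<otimes> t) = s" "(s \<otimes> t) \<otimes> s = t" "(s \<otimes> t) \<otimes> t = s" "s \<otimes> (s \<otimes> t) = t" "\<tau> (s \<otimes> t) = s"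
    using \<tau> by (simp_all add: commute left_commute m_assoc)
  interpret E2: edge_involutions G t b "s \<otimes> t"
    using edge_involutions_image[OF edge_involutions_axioms \<tau>(1)] \<tau> by simp
  interpret E3: edge_involutions G "s \<otimes> t" b s
    using edge_involutions_image[OF E2.edge_involutions_axioms \<tau>(1)] \<tau> products by simp
  interpret E1': edge_involutions G t b s
    by (rule swap)
  define I where "I = {0, 1, 2, 3::nat}"
  define H where "H = (!) [generate G {s, b}, generate G {s, t}, generate G {b, t}, generate G {b, s \<otimes> t}]"
  define \<Gamma> where "\<Gamma> = coset_pregeometry G I H"
  have wilson: "wilson_pregeometry G (s, b, t) = \<Gamma>"
    by (simp add: wilson_pregeometry_def \<Gamma>_def I_def H_def)
  have H: "H 0 = generate G {s, b}" "H (Suc 0) = generate G {s, t}" "H 2 = generate G {b, t}"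
    "H 3 = generate G {b, s \<otimes> t}"
    by (simp_all add: H_def)
  (* Type 1 is the type of the edges; the edge stabiliser is the same for all three pairs. *)
  have edge: "generate G {t, s \<otimes> t} = generate G {s, t}" "generate G {s \<otimes> t, s} = generate G {s, t}"
      "generate G {s, s \<otimes> t} = generate G {s, t}"
    using E2.generate_st E3.generate_st generate_st products by (auto simp: insert_commute)
  have sub: "subgroup (H i) G" if "i \<in> I" for i
    using that by (auto simp: I_def H intro!: generate_is_subgroup)
  have elem: "(i, H i) \<in> elements \<Gamma>" if "i \<in> I" for i
    using that sub[OF that] lcos_mult_one[of "H i"] subgroup.subset one_closed
    by (fastforce simp: \<Gamma>_def coset_pregeometry_def)
  have type: "type_of \<Gamma> x \<in> I" "type_of \<Gamma> x = fst x" if "x \<in> elements \<Gamma>" for x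
    using that by (auto simp: \<Gamma>_def coset_pregeometry_def)

  show "\<exists>\<alpha>. triality (wilson_pregeometry G (s, b, t)) \<alpha>"
  proof -
    define \<pi> where "\<pi> = id(0 := 2, 2 := 3, 3 := 0::nat)"
    define \<alpha> where "\<alpha> x = (if x \<in> elements \<Gamma> then map_prod \<pi> ((`) \<tau>) x else x)" for x
    have "bij_betw \<pi> I I"
      by (auto simp: \<pi>_def I_def bij_betw_def inj_on_def)
    moreover have "\<tau> ` H i = H (\<pi> i)" if "i \<in> I" for i
      using that \<tau>.generate_img[of "{s, b}"] \<tau>.generate_img[of "{s, t}"]
        \<tau>.generate_img[of "{b, t}"] \<tau>.generate_img[of "{b, s \<otimes> t}"]
      by (auto simp: I_def \<pi>_def H \<tau> products edge insert_commute)
    ultimately have cor: "correlation \<Gamma> \<alpha>"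
      using automorphism_induces_correlation[OF \<tau>(1), of \<pi> I H] subgroup.subset[OF sub]
      by (simp add: \<Gamma>_def[symmetric] \<alpha>_def[abs_def])
    then have perm: "\<alpha> permutes elements \<Gamma>"
      by (simp add: correlation_def)
    have type_\<alpha>: "type_of \<Gamma> (\<alpha> x) = \<pi> (type_of \<Gamma> x)" if "x \<in> elements \<Gamma>" for x
      using that type(2)[OF that] type(2)[of "\<alpha> x"] permutes_in_image[OF perm, of x]
      by (simp add: \<alpha>_def)
    have \<tau>_cubed: "\<tau> (\<tau> (\<tau> x)) = x" if "x \<in> carrier G" for x
      using hom_id_on_generators[of "\<lambda>x. \<tau> (\<tau> (\<tau> x))" x] that \<tau> products
      by (auto simp: hom_def)
    have "\<alpha> (\<alpha> (\<alpha> x)) = x" for x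
    proof (cases "x \<in> elements \<Gamma>")
      case True
      have in_elem: "\<alpha> x \<in> elements \<Gamma>" "\<alpha> (\<alpha> x) \<in> elements \<Gamma>"
        using True permutes_in_image[OF perm] by simp_all
      obtain i A where x: "x = (i, A)" "i \<in> I" "A \<subseteq> carrier G"
        using True subgroup.subset[OF sub] by (fastforce simp: \<Gamma>_def coset_pregeometry_def l_coset_def)
      have "\<pi> (\<pi> (\<pi> i)) = i"
        using x(2) by (auto simp: I_def \<pi>_def)
      moreover have "\<tau> ` \<tau> ` \<tau> ` A = A"
      proof -
        have "(\<lambda>y. \<tau> (\<tau> (\<tau> y))) ` A = (\<lambda>y. y) ` A"
          by (rule image_cong) (use \<tau>_cubed x(3) in blast)+
        then show ?thesis
          by (simp add: image_image)
      qed
      moreover have "\<alpha> (\<alpha> (\<alpha> x)) = map_prod \<pi> ((`) \<tau>) (map_prod \<pi> ((`) \<tau>) (map_prod \<pi> ((`) \<tau>) x))"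
        using True in_elem by (simp add: \<alpha>_def)
      ultimately show ?thesis
        using x(1) by simp
    qed (simp add: \<alpha>_def)
    then have "\<alpha> ^^ 3 = id"
      by (simp add: fun_eq_iff eval_nat_numeral)
    moreover have "\<alpha> ^^ m \<noteq> id" if "0 < m" "m < 3" for m
    proof
      assume id: "\<alpha> ^^ m = id"
      have el: "(0, H 0) \<in> elements \<Gamma>"
        using elem by (simp add: I_def)
      have "type_of \<Gamma> (0, H 0) = 0"
        using type(2)[OF el] by simp
      then have "type_of \<Gamma> (\<alpha> (0, H 0)) = 2"
        by (simp add: type_\<alpha>[OF el] \<pi>_def)
      moreover from this have "type_of \<Gamma> (\<alpha> (\<alpha> (0, H 0))) = 3"
        using type_\<alpha>[of "\<alpha> (0, H 0)"] el permutes_in_image[OF perm] by (simp add: \<pi>_def)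
      moreover have "m = 1 \<or> m = 2"
        using that by linarith
      ultimately show False
        using id \<open>type_of \<Gamma> (0, H 0) = 0\<close> by (auto simp: numeral_2_eq_2 fun_eq_iff)
    qed
    ultimately have order: "has_order \<alpha> 3"
      by (simp add: has_order_def)
    have "maps_type \<Gamma> \<alpha> 0 2" "maps_type \<Gamma> \<alpha> 2 3" "maps_type \<Gamma> \<alpha> 3 0"
      by (simp_all add: maps_type_def type_\<alpha> \<pi>_def)
    then have "(0::nat) \<noteq> 2 \<and> 2 \<noteq> (3::nat) \<and> (0::nat) \<noteq> 3 \<and>
        maps_type \<Gamma> \<alpha> 0 2 \<and> maps_type \<Gamma> \<alpha> 2 3 \<and> maps_type \<Gamma> \<alpha> 3 0"
      by simp
    moreover have "0 \<in> types \<Gamma>" "2 \<in> types \<Gamma>" "3 \<in> types \<Gamma>"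
      by (simp_all add: \<Gamma>_def coset_pregeometry_def I_def)
    ultimately have "triality \<Gamma> \<alpha>"
      unfolding triality_def using cor order by blast
    then show ?thesis
      by (auto simp: wilson)
  qed

  have not_commute: "s \<otimes> b \<noteq> b \<otimes> s" "t \<otimes> b \<noteq> b \<otimes> t" "(s \<otimes> t) \<otimes> b \<noteq> b \<otimes> (s \<otimes> t)"
  proof -
    have step: "x \<otimes> b = b \<otimes> x \<Longrightarrow> \<tau> x \<otimes> b = b \<otimes> \<tau> x" if "x \<in> carrier G" for x
      using \<tau>.hom_mult[OF that closed(2)] \<tau>.hom_mult[OF closed(2) that] \<tau>(3) by simp
    have "\<not> (s \<otimes> b = b \<otimes> s \<and> t \<otimes> b = b \<otimes> t)"
      using abelian_imp_swap E2.meets(3) aut(2) edge(1) by auto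
    then show "s \<otimes> b \<noteq> b \<otimes> s" "t \<otimes> b \<noteq> b \<otimes> t" "(s \<otimes> t) \<otimes> b \<noteq> b \<otimes> (s \<otimes> t)"
      using step[of s] step[of t] step[of "s \<otimes> t"] \<tau> products by auto
  qed
  have meet: "H j \<inter> {s, t, s \<otimes> t} \<noteq> {}" if "j \<in> I" for j
    using that by (auto simp: I_def H intro: generate.incl)
  have not_to_edge: "type_of \<Gamma> (\<alpha> x) \<noteq> 1"
    if cor: "correlation \<Gamma> \<alpha>" and x: "x \<in> elements \<Gamma>" "type_of \<Gamma> x \<noteq> 1" for \<alpha> x
  proof
    assume to: "type_of \<Gamma> (\<alpha> x) = 1"
    note cor' = cor[unfolded \<Gamma>_def] and x' = x(1)[unfolded \<Gamma>_def] and to' = to[unfolded \<Gamma>_def]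
    consider "type_of \<Gamma> x = 0" | "type_of \<Gamma> x = 2" | "type_of \<Gamma> x = 3"
      using type(1)[OF x(1)] x(2) by (auto simp: I_def)
    then show False
    proof cases
      case 1
      then show False
        using commute_if_mapped_to_edge[OF cor' _ _ _ _ _ sub _ x' _ to', of 0] meet not_commute(1)
        by (simp add: \<Gamma>_def I_def H)
    next
      case 2
      then show False
        using E1'.commute_if_mapped_to_edge[OF cor' _ _ _ _ _ sub _ x' _ to', of 2] meet not_commute(2)
        by (simp add: \<Gamma>_def I_def H insert_commute commute)
    next
      case 3
      then show False
        using E3.commute_if_mapped_to_edge[OF cor' _ _ _ _ _ sub _ x' _ to', of 3] meet not_commute(3)
        by (simp add: \<Gamma>_def I_def H insert_commute products edge)
    qed
  qed

  show "\<not> (\<exists>\<alpha>. duality (wilson_pregeometry G (s, b, t)) \<alpha>)"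
  proof
    assume "\<exists>\<alpha>. duality (wilson_pregeometry G (s, b, t)) \<alpha>"
    then obtain \<alpha> i j where cor: "correlation \<Gamma> \<alpha>" and order: "has_order \<alpha> 2"
      and ij: "i \<in> I" "j \<in> I" "i \<noteq> j" "maps_type \<Gamma> \<alpha> i j" "maps_type \<Gamma> \<alpha> j i"
      by (auto simp: duality_def wilson) (auto simp: \<Gamma>_def coset_pregeometry_def)
    have perm: "\<alpha> permutes elements \<Gamma>"
      and same_type: "type_of \<Gamma> x = type_of \<Gamma> y \<Longrightarrow> type_of \<Gamma> (\<alpha> x) = type_of \<Gamma> (\<alpha> y)"
      if "x \<in> elements \<Gamma>" "y \<in> elements \<Gamma>" for x y
      using cor that by (auto simp: correlation_def)
    have involutive: "\<alpha> (\<alpha> x) = x" for x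
    proof -
      have "(\<alpha> ^^ 2) x = id x"
        using order by (simp only: has_order_def)
      then show ?thesis
        by (simp add: numeral_2_eq_2)
    qed
    have to_edge: "k = 1" if "k \<in> I" "maps_type \<Gamma> \<alpha> k 1" for k
      using not_to_edge[OF cor elem[OF that(1)]] that type(2)[OF elem[OF that(1)]] elem[OF that(1)]
      unfolding maps_type_def by force
    have "i \<noteq> 1" "j \<noteq> 1"
      using to_edge[of i] to_edge[of j] ij by metis+
    have "(1, H 1) \<in> elements \<Gamma>"
      using elem by (simp add: I_def)
    then have "type_of \<Gamma> (\<alpha> (1, H 1)) = 1"
      using not_to_edge[OF cor, of "\<alpha> (1, H 1)"] permutes_in_image[OF perm, of "(1, H 1)"]
        type(2)[of "(1, H 1)"]
      by (simp only: involutive) auto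
    then have edges: "maps_type \<Gamma> \<alpha> 1 1"
      using same_type[of _ "(1, H 1)"] \<open>(1, H 1) \<in> elements \<Gamma>\<close> type(2)[of "(1, H 1)"]
      unfolding maps_type_def by (metis fst_conv)
    note cor' = cor[unfolded \<Gamma>_def] and edges' = edges[unfolded \<Gamma>_def]
    consider "maps_type \<Gamma> \<alpha> 0 2" "maps_type \<Gamma> \<alpha> 2 0"
      | "maps_type \<Gamma> \<alpha> 3 0" "maps_type \<Gamma> \<alpha> 0 3"
      | "maps_type \<Gamma> \<alpha> 2 3" "maps_type \<Gamma> \<alpha> 3 2"
      using ij \<open>i \<noteq> 1\<close> \<open>j \<noteq> 1\<close> by (auto simp: I_def)
    then show False
    proof cases
      case 1
      then show False
        using correlation_swap_imp_automorphism[OF cor' _ _ _ _ _ _ _ _ _ _ edges', of 0 2] aut(2)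
        by (simp add: \<Gamma>_def I_def H)
    next
      case 2
      then have "\<exists>\<phi> \<in> iso G G. \<phi> (s \<otimes> t) = s \<and> \<phi> b = b \<and> \<phi> s = s \<otimes> t"
        using E3.correlation_swap_imp_automorphism[OF cor' _ _ _ _ _ _ _ _ _ _ edges', of 3 0]
        by (simp add: \<Gamma>_def I_def H insert_commute edge)
      then obtain \<phi> where \<phi>: "\<phi> \<in> iso G G" "\<phi> (s \<otimes> t) = s" "\<phi> b = b" "\<phi> s = s \<otimes> t"
        by blast
      (* s and st are exchanged, so their product t is fixed. *)
      have "\<phi> (s \<otimes> (s \<otimes> t)) = \<phi> s \<otimes> \<phi> (s \<otimes> t)"
        using \<phi>(1) by (intro hom_mult[of _ G G]) (auto simp: iso_def)
      then show False
        using \<phi> products aut(3) by auto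
    next
      case 3
      then have "\<exists>\<phi> \<in> iso G G. \<phi> t = s \<otimes> t \<and> \<phi> b = b \<and> \<phi> (s \<otimes> t) = t"
        using E2.correlation_swap_imp_automorphism[OF cor' _ _ _ _ _ _ _ _ _ _ edges', of 2 3]
        by (simp add: \<Gamma>_def I_def H insert_commute edge)
      then obtain \<phi> where \<phi>: "\<phi> \<in> iso G G" "\<phi> t = s \<otimes> t" "\<phi> b = b" "\<phi> (s \<otimes> t) = t"
        by blast
      (* t and st are exchanged, so their product s is fixed. *)
      have "\<phi> ((s \<otimes> t) \<otimes> t) = \<phi> (s \<otimes> t) \<otimes> \<phi> t"
        using \<phi>(1) by (intro hom_mult[of _ G G]) (auto simp: iso_def)
      then show False
        using \<phi> products aut(4) by auto
    qed
  qed
qed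

section \<open>The distinguished generators of a reflexible map\<close>

lemma (in group) ord_2_imp_involution:
  assumes "x \<in> carrier G" "ord x = 2"
  shows "x \<noteq> \<one>" "x \<otimes> x = \<one>"
  using assms pow_ord_eq_1[OF assms(1)] by (auto simp: numeral_2_eq_2)

text \<open>
  The parabolic subgroups are contained in the stabilisers of \<open>v\<close>, \<open>e\<close> and \<open>f\<close>, so it suffices to
  intersect these. The uniqueness of \<open>\<rho>\<^sub>1\<close> makes the stabiliser of the flag trivial: if \<open>g\<close> fixes the flag, then
  \<open>g\<rho>\<^sub>1\<close> also has the property that characterises \<open>\<rho>\<^sub>1\<close>. Uniqueness of each generator then bounds
  the stabiliser of every pair of elements of the flag.
\<close>

lemma distinguished_generators_edge_involutions:
  assumes M: "is_map M" and flag: "(v, e, f) \<in> flags M"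
    and gens: "distinguished_generators M (v, e, f) (\<rho>0, \<rho>1, \<rho>2)"
  shows "edge_involutions (aut_group M) \<rho>0 \<rho>1 \<rho>2"
proof -
  define G where "G = aut_group M"
  interpret G: group G
    unfolding G_def by (rule group_aut_group[OF M])
  have flip:
      "{g \<in> carrier G. g e = e \<and> g f = f \<and> g v \<noteq> v} = {\<rho>0}"
      "{g \<in> carrier G. g v = v \<and> g f = f \<and> g e \<noteq> e} = {\<rho>1}"
      "{g \<in> carrier G. g v = v \<and> g e = e \<and> g f \<noteq> f} = {\<rho>2}"
    and ord: "G.ord \<rho>0 = 2" "G.ord \<rho>1 = 2" "G.ord \<rho>2 = 2"
    and comm: "\<rho>0 \<otimes>\<^bsub>G\<^esub> \<rho>2 = \<rho>2 \<otimes>\<^bsub>G\<^esub> \<rho>0"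
    and generated: "generate G {\<rho>0, \<rho>1, \<rho>2} = carrier G"
    using gens by (simp_all add: distinguished_generators_def Let_def G_def)
  have \<rho>: "\<rho>0 \<in> carrier G" "\<rho>0 e = e" "\<rho>0 f = f" "\<rho>0 v \<noteq> v"
    "\<rho>1 \<in> carrier G" "\<rho>1 v = v" "\<rho>1 f = f" "\<rho>1 e \<noteq> e"
    "\<rho>2 \<in> carrier G" "\<rho>2 v = v" "\<rho>2 e = e" "\<rho>2 f \<noteq> f"
    using flip[symmetric, THEN equalityD1] by simp_all
  have cells: "v \<in> cells M" "e \<in> cells M" "f \<in> cells M"
    using flag by (auto simp: flags_def cells_def)
  have bij: "g \<in> Bij (cells M)" if "g \<in> carrier G" for g
  proof -
    have "\<exists>h. g = restrict ((`) h) (cells M) \<and> map_homeomorphism M h"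
      using that by (simp add: G_def aut_group_def)
    then show ?thesis
      using map_homeomorphism_cells(1)[OF M] by (elim exE conjE) simp
  qed
  have act: "(g \<otimes>\<^bsub>G\<^esub> h) x = g (h x)" if "g \<in> carrier G" "h \<in> carrier G" "x \<in> cells M" for g h x
    using bij[OF that(1)] bij[OF that(2)] that(3)
    by (simp add: G_def aut_group_def BijGroup_def compose_eq)
  have inj: "x = y" if "g \<in> carrier G" "x \<in> cells M" "y \<in> cells M" "g x = g y" for g x y
    using bij[OF that(1)] that by (auto simp: Bij_def bij_betw_def inj_on_def)
  have one: "\<one>\<^bsub>G\<^esub> x = x" if "x \<in> cells M" for x
    using inj[OF G.one_closed, of "\<one>\<^bsub>G\<^esub> x" x] act[of "\<one>\<^bsub>G\<^esub>" "\<one>\<^bsub>G\<^esub>" x] that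
    by (simp add: G_def aut_group_def BijGroup_def)
  define stab where "stab x = {g \<in> carrier G. g x = x}" for x
  have stab_subgroup: "subgroup (stab x) G" if x: "x \<in> cells M" for x
  proof (rule G.subgroupI)
    show "inv\<^bsub>G\<^esub> g \<in> stab x" if "g \<in> stab x" for g
    proof -
      have g: "g \<in> carrier G" "g x = x"
        using that by (auto simp: stab_def)
      then have "(inv\<^bsub>G\<^esub> g) (g x) = x"
        using act[of "inv\<^bsub>G\<^esub> g" g x] x one by simp
      then show ?thesis
        using g by (simp add: stab_def)
    qed
  qed (use x act one in \<open>auto simp: stab_def\<close>)
  have flag_stab: "g = \<one>\<^bsub>G\<^esub>" if "g \<in> stab v" "g \<in> stab e" "g \<in> stab f" for g
  proof -
    have g: "g \<in> carrier G" "g v = v" "g e = e" "g f = f"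
      using that by (auto simp: stab_def)
    have "\<rho>1 e \<in> cells M"
      using bij[OF \<rho>(5)] cells(2) by (auto simp: Bij_def bij_betw_def)
    then have "g (\<rho>1 e) \<noteq> e"
      using inj[OF g(1), of "\<rho>1 e" e] cells g \<rho> by auto
    then have "g \<otimes>\<^bsub>G\<^esub> \<rho>1 \<in> {g \<in> carrier G. g v = v \<and> g f = f \<and> g e \<noteq> e}"
      using g \<rho> act[OF g(1) \<rho>(5)] cells by simp
    then show ?thesis
      using flip(2) g \<rho> by simp
  qed
  have pair_stab: "stab v \<inter> stab f \<subseteq> {\<one>\<^bsub>G\<^esub>, \<rho>1}" "stab e \<inter> stab f \<subseteq> {\<one>\<^bsub>G\<^esub>, \<rho>0}"
    "stab v \<inter> stab e \<subseteq> {\<one>\<^bsub>G\<^esub>, \<rho>2}"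
  proof -
    have "g = \<rho>1" if "g \<in> stab v" "g \<in> stab f" "g \<notin> stab e" for g
      using that flip(2)[THEN equalityD1] by (auto simp: stab_def)
    moreover have "g = \<rho>0" if "g \<in> stab e" "g \<in> stab f" "g \<notin> stab v" for g
      using that flip(1)[THEN equalityD1] by (auto simp: stab_def)
    moreover have "g = \<rho>2" if "g \<in> stab v" "g \<in> stab e" "g \<notin> stab f" for g
      using that flip(3)[THEN equalityD1] by (auto simp: stab_def)
    ultimately show "stab v \<inter> stab f \<subseteq> {\<one>\<^bsub>G\<^esub>, \<rho>1}" "stab e \<inter> stab f \<subseteq> {\<one>\<^bsub>G\<^esub>, \<rho>0}"
      "stab v \<inter> stab e \<subseteq> {\<one>\<^bsub>G\<^esub>, \<rho>2}"
      using flag_stab by blast+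
  qed
  have sub: "generate G {\<rho>0, \<rho>1} \<subseteq> stab f" "generate G {\<rho>0, \<rho>2} \<subseteq> stab e" "generate G {\<rho>1, \<rho>2} \<subseteq> stab v"
    by (rule G.generate_subgroup_incl; use \<rho> cells in \<open>simp add: stab_subgroup\<close>; simp add: stab_def)+
  have "edge_involutions G \<rho>0 \<rho>1 \<rho>2"
  proof unfold_locales
    show "\<rho>0 \<in> carrier G" "\<rho>1 \<in> carrier G" "\<rho>2 \<in> carrier G" "\<rho>0 \<noteq> \<rho>2"
      using \<rho> by auto
    show "\<rho>0 \<otimes>\<^bsub>G\<^esub> \<rho>0 = \<one>\<^bsub>G\<^esub>" "\<rho>1 \<otimes>\<^bsub>G\<^esub> \<rho>1 = \<one>\<^bsub>G\<^esub>" "\<rho>2 \<otimes>\<^bsub>G\<^esub> \<rho>2 = \<one>\<^bsub>G\<^esub>"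
      "\<rho>0 \<noteq> \<one>\<^bsub>G\<^esub>" "\<rho>2 \<noteq> \<one>\<^bsub>G\<^esub>"
      using \<rho> ord G.ord_2_imp_involution by simp_all
    show "\<rho>2 \<otimes>\<^bsub>G\<^esub> \<rho>0 = \<rho>0 \<otimes>\<^bsub>G\<^esub> \<rho>2"
      by (simp add: comm)
    show "generate G {\<rho>0, \<rho>1, \<rho>2} = carrier G"
      by (rule generated)
    show "generate G {\<rho>0, \<rho>1} \<inter> generate G {\<rho>1, \<rho>2} \<subseteq> {\<one>\<^bsub>G\<^esub>, \<rho>1}"
      "generate G {\<rho>0, \<rho>1} \<inter> generate G {\<rho>0, \<rho>2} \<subseteq> {\<one>\<^bsub>G\<^esub>, \<rho>0}"
      "generate G {\<rho>1, \<rho>2} \<inter> generate G {\<rho>0, \<rho>2} \<subseteq> {\<one>\<^bsub>G\<^esub>, \<rho>2}"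
      using pair_stab sub by blast+
  qed
  then show ?thesis
    by (simp add: G_def)
qed

theorem theorem10:
  fixes M :: "'a surface_map"
    and v e f :: "'a set"
    and \<rho>0 \<rho>1 \<rho>2 :: "'a set \<Rightarrow> 'a set"
  assumes "reflexible M"
    and "(v, e, f) \<in> flags M"
    and "distinguished_generators M (v, e, f) (\<rho>0, \<rho>1, \<rho>2)"
    and "class_III (aut_group M) (\<rho>0, \<rho>1, \<rho>2)"
  shows "(\<exists>\<alpha>. triality (wilson_pregeometry (aut_group M) (\<rho>0, \<rho>1, \<rho>2)) \<alpha>) \<and>
         \<not> (\<exists>\<alpha>. duality (wilson_pregeometry (aut_group M) (\<rho>0, \<rho>1, \<rho>2)) \<alpha>)"
proof -
  have "is_map M"
    using assms(1) by (simp add: reflexible_def)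
  then interpret edge_involutions "aut_group M" \<rho>0 \<rho>1 \<rho>2
    using assms(2,3) by (rule distinguished_generators_edge_involutions)
  show ?thesis
    using class_III_triality_no_duality[OF assms(4)] by blast
qed

end
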